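(* There exists a positive integer $N$ such that for every integer $n\ge N$ and every integer $k$ with $2\le k\le n$, the connected normal Cayley graph $\mathrm{Cay}(S_n,T(n,k))$ has the Aldous property, where $T(n,k)=\{\sigma\in S_n : 2\le|\mathrm{supp}(\sigma)|\le k\}$.
   Context: $S_n$ is the symmetric group on $[n]=\{1,2,\ldots,n\}$, $n\ge 3$. The support of $\sigma\in S_n$ is $\mathrm{supp}(\sigma)=\{i\in[n] : \sigma(i)\neq i\}$. For a finite group $G$ with identity $e$ and an inverse-closed subset $S\subseteq G\setminus\{e\}$, the Cayley graph $\mathrm{Cay}(G,S)$ is the simple undirected $|S|$-regular graph with vertex set $G$ and edge set $\{\{g,gs\} : g\in G, s\in S\}$. It is called a normal Cayley graph if $S$ is closed under conjugation in $G$. The eigenvalues of a graph are those of its adjacency matrix, listed with multiplicity in non-ascending order $\lambda_1\ge\lambda_2\ge\cdots$; similarly $\lambda_1(M)$ denotes the largest eigenvalue of a matrix $M$ with real eigenvalues. The standard representation $\rho_{(n-1,1)}$ of $S_n$ is the irreducible complex representation (Specht module) corresponding to the partition $(n-1,1)$ of $n$; it has dimension $n-1$ and character $\chi_{(n-1,1)}(\sigma)=(\text{number of fixed points of }\sigma)-1$. For $S\subseteq S_n$ put $\rho_{(n-1,1)}(S)=\sum_{s\in S}\rho_{(n-1,1)}(s)$. Aldous property: $\mathrm{Cay}(S_n,S)$ has the Aldous property if its strictly second largest eigenvalue (the largest eigenvalue strictly smaller than the degree $|S|$) is attained by the standard representation, that is, $\lambda_{t+1}(\mathrm{Cay}(S_n,S))=\lambda_1(\rho_{(n-1,1)}(S))$,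 where $t=[S_n:\langle S\rangle]$ is the index in $S_n$ of the subgroup generated by $S$. (When $S$ is closed under conjugation, $\rho_{(n-1,1)}(S)$ is a scalar matrix and $\lambda_1(\rho_{(n-1,1)}(S))=\sum_{\sigma\in S}\chi_{(n-1,1)}(\sigma)/(n-1)$.) *)

theory Defs
  imports
    "HOL-Algebra.Sym_Groups"
    "HOL-Algebra.Generated_Groups"
    "HOL-Computational_Algebra.Fundamental_Theorem_Algebra"
    "Graph_Theory.Pair_Digraph"
    "Graph_Theory.Digraph_Component"
    "Jordan_Normal_Form.Char_Poly"
begin

section \<open>Cayley graphs\<close>

definition connection_set :: "('a, 'b) monoid_scheme \<Rightarrow> 'a set \<Rightarrow> bool" where
  "connection_set G S \<longleftrightarrow>
     S \<subseteq> carrier G - {\<one>\<^bsub>G\<^esub>} \<and> (\<forall>s\<in>S. inv\<^bsub>G\<^esub> s \<in> S)"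

definition normal_connection_set :: "('a, 'b) monoid_scheme \<Rightarrow> 'a set \<Rightarrow> bool" where
  "normal_connection_set G S \<longleftrightarrow>
     connection_set G S \<and> (\<forall>g\<in>carrier G. \<forall>s\<in>S. g \<otimes>\<^bsub>G\<^esub> s \<otimes>\<^bsub>G\<^esub> inv\<^bsub>G\<^esub> g \<in> S)"

text \<open>A simple undirected graph is a symmetric loop-free digraph (\<^locale>\<open>pair_graph\<close>): the
  edge \<open>{u, v}\<close> is the pair of arcs \<open>(u, v)\<close>, \<open>(v, u)\<close>.\<close>

definition cayley_graph :: "('a, 'b) monoid_scheme \<Rightarrow> 'a set \<Rightarrow> 'a pair_pre_digraph" where
  "cayley_graph G S =
     \<lparr> pverts = carrier G, parcs = {(g, g \<otimes>\<^bsub>G\<^esub> s) | g s. g \<in> carrier G \<and> s \<in> S} \<rparr>"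

lemma pair_graph_cayley_graph:
  assumes "group G" "finite (carrier G)" "connection_set G S"
  shows "pair_graph (cayley_graph G S)"
proof -
  interpret group G by fact
  have sub: "S \<subseteq> carrier G" and one: "\<one>\<^bsub>G\<^esub> \<notin> S" and inv: "\<And>s. s \<in> S \<Longrightarrow> inv\<^bsub>G\<^esub> s \<in> S"
    using assms(3) by (auto simp: connection_set_def)
  have arcs: "parcs (cayley_graph G S) \<subseteq> carrier G \<times> carrier G"
    using sub by (auto simp: cayley_graph_def)
  have verts: "pverts (cayley_graph G S) = carrier G"
    by (simp add: cayley_graph_def)
  have rev: "(v, u) \<in> parcs (cayley_graph G S)" if "(u, v) \<in> parcs (cayley_graph G S)" for u v
  proof -
    from that obtain s where s: "u \<in> carrier G" "s \<in> S" "v = u \<otimes>\<^bsub>G\<^esub> s"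
      by (auto simp: cayley_graph_def)
    then have "v \<in> carrier G" "u = v \<otimes>\<^bsub>G\<^esub> inv\<^bsub>G\<^esub> s" "inv\<^bsub>G\<^esub> s \<in> S"
      using sub inv by (auto simp: m_assoc subset_eq)
    then show ?thesis by (auto simp: cayley_graph_def)
  qed
  show ?thesis
  proof
    show "fst e \<in> pverts (cayley_graph G S)" "snd e \<in> pverts (cayley_graph G S)"
      if "e \<in> parcs (cayley_graph G S)" for e
      using that arcs verts by auto
    show "finite (pverts (cayley_graph G S))" "finite (parcs (cayley_graph G S))"
      using assms(2) arcs verts by (auto intro: finite_subset)
    show "fst e \<noteq> snd e" if "e \<in> parcs (cayley_graph G S)" for e
      using that sub one by (auto simp: cayley_graph_def)
    show "symmetric (with_proj (cayley_graph G S))"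
      using rev by (auto simp: symmetric_def intro: symI)
  qed
qed


section \<open>Eigenvalues\<close>

text \<open>Eigenvalues with (algebraic) multiplicity in non-ascending order. This is meant for matrices
  all of whose eigenvalues are real; only then does \<^const>\<open>Re\<close> lose nothing. Indices start
  at 1.\<close>

definition eigenvalues_desc :: "complex mat \<Rightarrow> real list" where
  "eigenvalues_desc A = rev (sorted_list_of_multiset (image_mset Re (proots (char_poly A))))"

definition nth_eigenvalue :: "nat \<Rightarrow> complex mat \<Rightarrow> real" where
  "nth_eigenvalue i A = eigenvalues_desc A ! (i - 1)"

text \<open>Rows and columns follow an arbitrary enumeration of the vertices. Different enumerations give
  matrices conjugate by a permutation matrix, hence the same eigenvalues.\<close>

definition vertex_enumeration :: "'a pair_pre_digraph \<Rightarrow> 'a list" where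
  "vertex_enumeration X = (SOME vs. distinct vs \<and> set vs = pverts X)"

definition adjacency_matrix :: "'a pair_pre_digraph \<Rightarrow> complex mat" where
  "adjacency_matrix X =
     (let vs = vertex_enumeration X
      in mat (length vs) (length vs) (\<lambda>(i, j). if (vs ! i, vs ! j) \<in> parcs X then 1 else 0))"


section \<open>The standard representation\<close>

text \<open>The permutation module of shape \<open>(n - 1, 1)\<close> has basis \<open>e\<^sub>1, \<dots>, e\<^sub>n\<close> (a tabloid is determined
  by the entry of its second row). Its Specht submodule consists of the vectors with coordinate
  sum 0, and the standard polytabloids \<open>e\<^sub>j - e\<^sub>1\<close> (\<open>2 \<le> j \<le> n\<close>) form a basis of it. The
  representation below is the action in this basis:
  \<open>\<sigma> (e\<^sub>j - e\<^sub>1) = (e\<^sub>\<sigma>\<^sub>(\<^sub>j\<^sub>) - e\<^sub>1) - (e\<^sub>\<sigma>\<^sub>(\<^sub>1\<^sub>) - e\<^sub>1)\<close>. Since matrix indices start at 0,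
  index \<open>j\<close> stands for the basis vector \<open>e\<^sub>j\<^sub>+\<^sub>2 - e\<^sub>1\<close>.\<close>

definition std_rep :: "nat \<Rightarrow> (nat \<Rightarrow> nat) \<Rightarrow> complex mat" where
  "std_rep n \<sigma> = mat (n - 1) (n - 1)
     (\<lambda>(i, j). (if \<sigma> (j + 2) = i + 2 then 1 else 0) - (if \<sigma> 1 = i + 2 then 1 else 0))"

definition perm_matrix :: "nat \<Rightarrow> (nat \<Rightarrow> nat) \<Rightarrow> complex mat" where
  "perm_matrix n \<sigma> = mat n n (\<lambda>(i, j). if \<sigma> (j + 1) = i + 1 then 1 else 0)"

definition polytabloid_matrix :: "nat \<Rightarrow> complex mat" where
  "polytabloid_matrix n =
     mat n (n - 1) (\<lambda>(i, j). (if i = j + 1 then 1 else 0) - (if i = 0 then 1 else 0))"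

lemma sum_shift_indicator:
  fixes f :: "nat \<Rightarrow> complex"
  assumes "y \<in> {1..n}"
  shows "(\<Sum>k = 0..<n - 1. f (k + 2) * (if y = k + 2 then 1 else 0)) = (if y = 1 then 0 else f y)"
proof (cases "y = 1")
  case False
  then have y: "y - 2 < n - 1" "y = (y - 2) + 2" using assms by auto
  have "(\<Sum>k = 0..<n - 1. f (k + 2) * (if y = k + 2 then 1 else 0))
      = (\<Sum>k = 0..<n - 1. if k = y - 2 then f y else 0)"
    using y(2) by (intro sum.cong) auto
  with y False show ?thesis by simp
qed (auto intro: sum.neutral)

lemma perm_matrix_polytabloid_matrix:
  assumes "\<sigma> permutes {1..n}"
  shows "perm_matrix n \<sigma> * polytabloid_matrix n = polytabloid_matrix n * std_rep n \<sigma>"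
proof (rule eq_matI)
  fix i j assume "i < dim_row (polytabloid_matrix n * std_rep n \<sigma>)"
    "j < dim_col (polytabloid_matrix n * std_rep n \<sigma>)"
  then have ij: "i < n" "j < n - 1" by (auto simp: polytabloid_matrix_def std_rep_def)
  have in1: "\<sigma> (j + 2) \<in> {1..n}" and in2: "\<sigma> 1 \<in> {1..n}"
    using ij permutes_in_image[OF assms, of "j + 2"] permutes_in_image[OF assms, of 1] by auto
  have "(perm_matrix n \<sigma> * polytabloid_matrix n) $$ (i, j)
      = (\<Sum>k = 0..<n. (if \<sigma> (k + 1) = i + 1 then 1 else 0)
          * ((if k = j + 1 then 1 else 0) - (if k = 0 then 1 else 0)))"
    using ij by (simp add: perm_matrix_def polytabloid_matrix_def scalar_prod_def)
  also have "\<dots> = (\<Sum>k = 0..<n. if k = j + 1 then (if \<sigma> (k + 1) = i + 1 then 1 else 0) else 0)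
      - (\<Sum>k = 0..<n. if k = 0 then (if \<sigma> (k + 1) = i + 1 then 1 else 0) else 0)"
    unfolding sum_subtractf[symmetric] by (intro sum.cong) auto
  also have "\<dots> = (if \<sigma> (j + 2) = i + 1 then 1 else 0) - (if \<sigma> 1 = i + 1 then 1 else 0)"
    using ij by auto
  finally have L: "(perm_matrix n \<sigma> * polytabloid_matrix n) $$ (i, j)
      = (if \<sigma> (j + 2) = i + 1 then 1 else 0) - (if \<sigma> 1 = i + 1 then 1 else 0)" .
  have R: "(polytabloid_matrix n * std_rep n \<sigma>) $$ (i, j)
      = (\<Sum>k = 0..<n - 1. ((if i = k + 1 then 1 else 0) - (if i = 0 then 1 else 0))
          * ((if \<sigma> (j + 2) = k + 2 then 1 else 0) - (if \<sigma> 1 = k + 2 then 1 else 0)))"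
    using ij by (simp add: std_rep_def polytabloid_matrix_def scalar_prod_def)
  also have "\<dots> = (\<Sum>k = 0..<n - 1. ((if i = k + 1 then 1 else 0) - (if i = 0 then 1 else 0))
          * (if \<sigma> (j + 2) = k + 2 then 1 else 0))
      - (\<Sum>k = 0..<n - 1. ((if i = k + 1 then 1 else 0) - (if i = 0 then 1 else 0))
          * (if \<sigma> 1 = k + 2 then 1 else 0))"
    by (simp only: sum_subtractf[symmetric] right_diff_distrib)
  also have "\<dots> = (if \<sigma> (j + 2) = i + 1 then 1 else 0) - (if \<sigma> 1 = i + 1 then 1 else 0)"
    using sum_shift_indicator[OF in1, of "\<lambda>x. (if i = x - 1 then 1 else 0) - (if i = 0 then 1 else 0)"]
      sum_shift_indicator[OF in2, of "\<lambda>x. (if i = x - 1 then 1 else 0) - (if i = 0 then 1 else 0)"]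
      in1 in2 by auto
  finally show "(perm_matrix n \<sigma> * polytabloid_matrix n) $$ (i, j)
      = (polytabloid_matrix n * std_rep n \<sigma>) $$ (i, j)"
    using L by simp
qed (auto simp: perm_matrix_def polytabloid_matrix_def std_rep_def)

lemma std_rep_comp:
  assumes "\<sigma> permutes {1..n}" "\<tau> permutes {1..n}"
  shows "std_rep n (\<sigma> \<circ> \<tau>) = std_rep n \<sigma> * std_rep n \<tau>"
proof (rule eq_matI)
  fix i j assume "i < dim_row (std_rep n \<sigma> * std_rep n \<tau>)" "j < dim_col (std_rep n \<sigma> * std_rep n \<tau>)"
  then have ij: "i < n - 1" "j < n - 1" by (auto simp: std_rep_def)
  have in1: "\<tau> (j + 2) \<in> {1..n}" and in2: "\<tau> 1 \<in> {1..n}"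
    using ij permutes_in_image[OF assms(2), of "j + 2"] permutes_in_image[OF assms(2), of 1] by auto
  define f :: "nat \<Rightarrow> complex"
    where "f x = (if \<sigma> x = i + 2 then 1 else 0) - (if \<sigma> 1 = i + 2 then 1 else 0)" for x
  have "(std_rep n \<sigma> * std_rep n \<tau>) $$ (i, j) = (\<Sum>k = 0..<n - 1. f (k + 2)
          * ((if \<tau> (j + 2) = k + 2 then 1 else 0) - (if \<tau> 1 = k + 2 then 1 else 0)))"
    using ij by (simp add: std_rep_def scalar_prod_def f_def)
  also have "\<dots> = (\<Sum>k = 0..<n - 1. f (k + 2) * (if \<tau> (j + 2) = k + 2 then 1 else 0))
      - (\<Sum>k = 0..<n - 1. f (k + 2) * (if \<tau> 1 = k + 2 then 1 else 0))"
    by (simp only: sum_subtractf[symmetric] right_diff_distrib)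
  also have "\<dots> = f (\<tau> (j + 2)) - f (\<tau> 1)"
    using sum_shift_indicator[OF in1, of f] sum_shift_indicator[OF in2, of f] by (auto simp: f_def)
  also have "\<dots> = std_rep n (\<sigma> \<circ> \<tau>) $$ (i, j)"
    using ij by (simp add: std_rep_def f_def)
  finally show "std_rep n (\<sigma> \<circ> \<tau>) $$ (i, j) = (std_rep n \<sigma> * std_rep n \<tau>) $$ (i, j)" by simp
qed (auto simp: std_rep_def)

lemma std_rep_id: "std_rep n id = 1\<^sub>m (n - 1)"
  by (rule eq_matI) (auto simp: std_rep_def)

lemma std_rep_character:
  assumes "\<sigma> permutes {1..n}" "n \<ge> 1"
  shows "(\<Sum>i = 0..<n - 1. std_rep n \<sigma> $$ (i, i)) = of_nat (card {i\<in>{1..n}. \<sigma> i = i}) - 1"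
proof -
  have in1: "\<sigma> 1 \<in> {1..n}" using assms permutes_in_image[OF assms(1), of 1] by auto
  have "{1..n} = insert 1 {2..n}" using assms(2) by auto
  have "of_nat (card {i\<in>{1..n}. \<sigma> i = i}) = (\<Sum>i\<in>{1..n}. if \<sigma> i = i then 1 else 0 :: complex)"
    by (simp add: sum.If_cases Int_def)
  also have "\<dots> = (if \<sigma> 1 = 1 then 1 else 0) + (\<Sum>i\<in>{2..n}. if \<sigma> i = i then 1 else 0)"
    unfolding \<open>{1..n} = insert 1 {2..n}\<close> by simp
  also have "(\<Sum>i\<in>{2..n}. if \<sigma> i = i then 1 else 0 :: complex)
      = (\<Sum>i = 0..<n - 1. if \<sigma> (i + 2) = i + 2 then 1 else 0)"
    by (rule sum.reindex_bij_witness[of _ "\<lambda>i. i + 2" "\<lambda>i. i - 2"])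
      (auto simp del: add_2_eq_Suc')
  finally have card_eq: "of_nat (card {i\<in>{1..n}. \<sigma> i = i})
      = (if \<sigma> 1 = 1 then 1 else 0)
        + (\<Sum>i = 0..<n - 1. if \<sigma> (i + 2) = i + 2 then 1 else 0 :: complex)" .
  have "(\<Sum>i = 0..<n - 1. std_rep n \<sigma> $$ (i, i))
      = (\<Sum>i = 0..<n - 1. if \<sigma> (i + 2) = i + 2 then 1 else 0)
        - (\<Sum>i = 0..<n - 1. if \<sigma> 1 = i + 2 then 1 else 0)"
    unfolding sum_subtractf[symmetric] by (intro sum.cong) (auto simp: std_rep_def)
  then show ?thesis
    using sum_shift_indicator[OF in1, of "\<lambda>_. 1"] card_eq by simp
qed

definition std_rep_sum :: "nat \<Rightarrow> (nat \<Rightarrow> nat) set \<Rightarrow> complex mat" where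
  "std_rep_sum n S = mat (n - 1) (n - 1) (\<lambda>(i, j). \<Sum>s\<in>S. std_rep n s $$ (i, j))"


section \<open>The Aldous property\<close>

definition aldous_property :: "nat \<Rightarrow> (nat \<Rightarrow> nat) set \<Rightarrow> bool" where
  "aldous_property n S \<longleftrightarrow>
     (let t = card (rcosets\<^bsub>sym_group n\<^esub> (generate (sym_group n) S))
      in nth_eigenvalue (t + 1) (adjacency_matrix (cayley_graph (sym_group n) S))
           = nth_eigenvalue 1 (std_rep_sum n S))"

definition perm_supp :: "nat \<Rightarrow> (nat \<Rightarrow> nat) \<Rightarrow> nat set" where
  "perm_supp n \<sigma> = {i\<in>{1..n}. \<sigma> i \<noteq> i}"

definition small_support_perms :: "nat \<Rightarrow> nat \<Rightarrow> (nat \<Rightarrow> nat) set" where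
  "small_support_perms n k =
     {\<sigma> \<in> carrier (sym_group n). 2 \<le> card (perm_supp n \<sigma>) \<and> card (perm_supp n \<sigma>) \<le> k}"

end

theory Submission
  imports Defs
begin

text \<open>
  Put \<open>j = n - k\<close>. Two permutations \<open>g\<close>, \<open>h\<close> are equal or adjacent in the Cayley graph iff they agree
  in at least \<open>j\<close> points, so the adjacency matrix plus the identity has the entries
  \<open>[j \<le> agreement g h]\<close>. Its quadratic form is analysed through the energies
  \<open>E\<^sub>i(v) = \<Sum>\<^sub>g\<^sub>,\<^sub>h v(g) v(h) (agreement g h)\<^sub>i\<close>, where \<open>(m)\<^sub>i\<close> is the falling factorial: \<open>E\<^sub>i(v)\<close> is the
  sum of the squares of the sums of \<open>v\<close> over the fibres of the restrictions of permutations to \<open>i\<close>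
  points, taken in all orders.

  Two facts carry the proof. Inclusion-exclusion gives, for \<open>j \<ge> 1\<close>,
  \<open>(j - 1)! \<langle>v, (A + I) v\<rangle> = \<Sum>\<^sub>l (-1)\<^sup>l / l! \<cdot> E\<^sub>j\<^sub>+\<^sub>l(v) / (j + l)\<close> (lemma \<open>threshold_expansion\<close>).
  And if \<open>v\<close> has sum zero, then \<open>E\<^sub>i(v) / i\<close> is nondecreasing in \<open>i\<close> for \<open>1 \<le> i < n\<close>
  (lemma \<open>energy_ratio_mono\<close>), with the last value \<open>E\<^sub>n\<^sub>-\<^sub>1(v) / (n - 1) = n! |v|\<^sup>2 / (n - 1)\<close>. For vectors of
  the standard representation \<open>E\<^sub>i(v) / i\<close> is constant on this range. Hence the eigenvalue of the
  standard representation times \<open>|v|\<^sup>2\<close>, minus the quadratic form at \<open>v\<close>, is a positive multiple of an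
  alternating sum \<open>\<Sum>\<^sub>l (-1)\<^sup>l h\<^sub>l / l!\<close> in which \<open>h\<close> is nonnegative and decreasing, and such a sum is
  nonnegative (lemma \<open>agreement_form_bound\<close>). This bounds every eigenvalue with an eigenvector of sum
  zero; for \<open>j = 0\<close> the graph is complete, and both the form and the
  eigenvalue of \<open>A + I\<close> are zero. The argument works from \<open>n = 3\<close> on.

  The monotonicity is proved by induction: prescribing one value \<open>g a = b\<close> expresses \<open>E\<^sub>i\<^sub>+\<^sub>1\<close> by the
  energies \<open>E\<^sub>i\<close> of smaller sets of bijections. The base case \<open>2 E\<^sub>1 \<le> E\<^sub>2\<close> is a least-squares problem:
  among all arrays indexed by two pairs (point, value) whose marginals are the sums of \<open>v\<close> over the sets
  \<open>{g. g a = b}\<close>, the smallest sum of squares can be computed explicitly (lemma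
  \<open>pair_marginal_sq_sum\<close>).

  The rest translates between the form and the sorted list of eigenvalues. The rows and columns of the
  adjacency matrix sum to the degree, and dividing out the constant vectors leaves a matrix whose
  eigenvalues all have eigenvectors of sum zero.
\<close>

section \<open>Energies of functions on sets of bijections\<close>

definition agreement :: "'a set \<Rightarrow> ('a \<Rightarrow> 'b) \<Rightarrow> ('a \<Rightarrow> 'b) \<Rightarrow> nat" where
  "agreement A g h = card {a \<in> A. g a = h a}"

lemma agreement_self: "agreement A g g = card A"
  by (simp add: agreement_def)

lemma agreement_le: "finite A \<Longrightarrow> agreement A g h \<le> card A"
  unfolding agreement_def by (rule card_mono) auto

text \<open>The factor \<open>fact i * (m choose i)\<close> is the falling factorial of \<open>m\<close>, the number of ordered choices
  of \<open>i\<close> points of agreement.\<close>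
definition energy :: "nat \<Rightarrow> 'a set \<Rightarrow> ('a \<Rightarrow> 'b) set \<Rightarrow> (('a \<Rightarrow> 'b) \<Rightarrow> real) \<Rightarrow> real" where
  "energy i A G v =
     (\<Sum>g\<in>G. \<Sum>h\<in>G. v g * v h * (fact i * real (agreement A g h choose i)))"

lemma energy_0: "energy 0 A G v = (\<Sum>g\<in>G. v g)\<^sup>2"
  by (simp add: energy_def power2_eq_square sum_product)

lemma falling_agreement_rec:
  assumes "finite A"
  shows "fact (Suc i) * real (agreement A g h choose Suc i) =
    (\<Sum>a\<in>A. if g a = h a then fact i * real (agreement (A - {a}) g h choose i) else 0)"
proof -
  let ?m = "agreement A g h"
  have *: "agreement (A - {a}) g h = ?m - 1" if "a \<in> A" "g a = h a" for a
  proof -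
    have "{x \<in> A - {a}. g x = h x} = {x \<in> A. g x = h x} - {a}" by auto
    then show ?thesis using that assms by (simp add: agreement_def)
  qed
  have "(\<Sum>a\<in>A. if g a = h a then fact i * real (agreement (A - {a}) g h choose i) else 0)
      = (\<Sum>a\<in>A. if g a = h a then fact i * real ((?m - 1) choose i) else 0)"
    using * by (intro sum.cong) auto
  also have "\<dots> = real ?m * (fact i * real ((?m - 1) choose i))"
    using assms by (simp add: sum.If_cases agreement_def Int_def)
  also have "\<dots> = fact i * real (?m * ((?m - 1) choose i))" by simp
  also have "?m * ((?m - 1) choose i) = Suc i * (?m choose Suc i)"
    by (metis binomial_absorption)
  finally show ?thesis by (simp add: algebra_simps)
qed

text \<open>An ordered choice of \<open>i + 1\<close> points of agreement is a first point \<open>a\<close>, with the common value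
  \<open>b\<close>, followed by a choice of \<open>i\<close> other points.\<close>
lemma energy_Suc:
  assumes "finite A" "finite B" "finite G" "\<And>g a. g \<in> G \<Longrightarrow> a \<in> A \<Longrightarrow> g a \<in> B"
  shows "energy (Suc i) A G v = (\<Sum>a\<in>A. \<Sum>b\<in>B. energy i (A - {a}) {g\<in>G. g a = b} v)"
proof -
  let ?f = "\<lambda>a g h. fact i * real (agreement (A - {a}) g h choose i)"
  have "energy i (A - {a}) {g\<in>G. g a = b} v
      = (\<Sum>g\<in>G. \<Sum>h\<in>G. if g a = b \<and> h a = b then v g * v h * ?f a g h else 0)" for a b
    unfolding energy_def using assms(3)
    by (simp add: sum.inter_filter if_distrib cong: if_cong) (auto intro!: sum.cong sum.neutral)
  then have "(\<Sum>a\<in>A. \<Sum>b\<in>B. energy i (A - {a}) {g\<in>G. g a = b} v)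
      = (\<Sum>a\<in>A. \<Sum>b\<in>B. \<Sum>g\<in>G. \<Sum>h\<in>G. if g a = b \<and> h a = b then v g * v h * ?f a g h else 0)"
    by simp
  also have "\<dots> = (\<Sum>a\<in>A. \<Sum>g\<in>G. \<Sum>h\<in>G. \<Sum>b\<in>B. if g a = b \<and> h a = b then v g * v h * ?f a g h else 0)"
  proof (rule sum.cong[OF refl])
    fix a
    show "(\<Sum>b\<in>B. \<Sum>g\<in>G. \<Sum>h\<in>G. if g a = b \<and> h a = b then v g * v h * ?f a g h else 0)
        = (\<Sum>g\<in>G. \<Sum>h\<in>G. \<Sum>b\<in>B. if g a = b \<and> h a = b then v g * v h * ?f a g h else 0)"
      by (subst sum.swap, subst (2) sum.swap) simp
  qed
  also have "\<dots> = (\<Sum>a\<in>A. \<Sum>g\<in>G. \<Sum>h\<in>G. if g a = h a then v g * v h * ?f a g h else 0)"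
  proof (intro sum.cong refl)
    fix a g h assume "a \<in> A" "g \<in> G" "h \<in> G"
    then have "g a \<in> B" using assms(4) by auto
    have "(\<Sum>b\<in>B. if g a = b \<and> h a = b then v g * v h * ?f a g h else 0)
        = (\<Sum>b\<in>B. if b = g a then (if g a = h a then v g * v h * ?f a g h else 0) else 0)"
      by (intro sum.cong) auto
    then show "(\<Sum>b\<in>B. if g a = b \<and> h a = b then v g * v h * ?f a g h else 0)
        = (if g a = h a then v g * v h * ?f a g h else 0)"
      using \<open>g a \<in> B\<close> assms(2) by simp
  qed
  also have "\<dots> = (\<Sum>g\<in>G. \<Sum>h\<in>G. \<Sum>a\<in>A. if g a = h a then v g * v h * ?f a g h else 0)"
    by (subst sum.swap, subst (2) sum.swap) simp
  also have "\<dots> = (\<Sum>g\<in>G. \<Sum>h\<in>G. v g * v h * (\<Sum>a\<in>A. if g a = h a then ?f a g h else 0))"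
    by (simp add: sum_distrib_left if_distrib cong: if_cong)
  also have "\<dots> = energy (Suc i) A G v"
    unfolding energy_def falling_agreement_rec[OF assms(1)] ..
  finally show ?thesis ..
qed

lemma sum_off_diagonal_swap:
  assumes "finite A"
  shows "(\<Sum>a\<in>A. \<Sum>c\<in>A - {a}. f a c) = (\<Sum>c\<in>A. \<Sum>a\<in>A - {c}. f a c :: 'b::comm_monoid_add)"
proof -
  have *: "A - {a} = {c\<in>A. a \<noteq> c}" "A - {a} = {c\<in>A. c \<noteq> a}" for a by auto
  have "(\<Sum>a\<in>A. \<Sum>c\<in>{c\<in>A. a \<noteq> c}. f a c) = (\<Sum>c\<in>A. \<Sum>a\<in>{a\<in>A. a \<noteq> c}. f a c)"
    by (rule sum.swap_restrict[OF assms assms])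
  then show ?thesis by (simp only: *[symmetric])
qed

text \<open>The arrays \<open>S\<close> with the given marginals form an affine space, and \<open>T\<close> in the proof is its
  point closest to the origin: \<open>T\<close> is a combination of marginal terms, so its inner product with every
  array in the space is the same number \<open>2 * W - m\<^sup>2\<close>, which is then also the square sum of \<open>T\<close>.\<close>
lemma pair_marginal_sq_sum:
  fixes M :: "'a \<Rightarrow> 'b \<Rightarrow> real" and S :: "'a \<Rightarrow> 'b \<Rightarrow> 'a \<Rightarrow> 'b \<Rightarrow> real"
  assumes fin: "finite A" "finite B" and card: "card A = n" "card B = n" and n: "n \<ge> 3"
    and row: "\<And>a. a \<in> A \<Longrightarrow> (\<Sum>b\<in>B. M a b) = m"
    and col: "\<And>b. b \<in> B \<Longrightarrow> (\<Sum>a\<in>A. M a b) = m"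
    and S1: "\<And>a b c. a \<in> A \<Longrightarrow> b \<in> B \<Longrightarrow> c \<in> A - {a} \<Longrightarrow> (\<Sum>d\<in>B - {b}. S a b c d) = M a b"
    and S2: "\<And>a c d. a \<in> A \<Longrightarrow> c \<in> A - {a} \<Longrightarrow> d \<in> B \<Longrightarrow> (\<Sum>b\<in>B - {d}. S a b c d) = M c d"
  shows "2 * (\<Sum>a\<in>A. \<Sum>b\<in>B. (M a b)\<^sup>2)
     \<le> (\<Sum>a\<in>A. \<Sum>b\<in>B. \<Sum>c\<in>A - {a}. \<Sum>d\<in>B - {b}. (S a b c d)\<^sup>2) + m\<^sup>2"
proof -
  define N :: real where "N = real n - 1"
  have N: "N \<ge> 2" using n by (simp add: N_def)
  have n1: "real (n - 1) = N" using n by (simp add: N_def of_nat_diff)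
  define D where "D X = (\<Sum>a\<in>A. \<Sum>c\<in>A - {a}. \<Sum>b\<in>B. \<Sum>d\<in>B - {b}. X a b c d)"
    for X :: "'a \<Rightarrow> 'b \<Rightarrow> 'a \<Rightarrow> 'b \<Rightarrow> real"
  define W where "W = (\<Sum>a\<in>A. \<Sum>b\<in>B. (M a b)\<^sup>2)"
  have D_add: "D (\<lambda>a b c d. X a b c d + Y a b c d) = D X + D Y" for X Y
    by (simp add: D_def sum.distrib)
  have D_mult: "D (\<lambda>a b c d. k * X a b c d) = k * D X" for X k
    by (simp add: D_def sum_distrib_left)
  have row': "(\<Sum>d\<in>B - {b}. M a d) = m - M a b" if "a \<in> A" "b \<in> B" for a b
    using row[OF that(1)] fin that by (simp add: sum_diff1)
  have col': "(\<Sum>c\<in>A - {a}. M c b) = m - M a b" if "a \<in> A" "b \<in> B" for a b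
    using col[OF that(2)] fin that by (simp add: sum_diff1)
  have W2: "(\<Sum>a\<in>A. \<Sum>b\<in>B. M a b * (m - M a b)) = (N + 1) * m\<^sup>2 - W"
  proof -
    have "(\<Sum>a\<in>A. \<Sum>b\<in>B. M a b * (m - M a b)) = (\<Sum>a\<in>A. m * (\<Sum>b\<in>B. M a b)) - W"
      by (simp add: W_def right_diff_distrib sum_subtractf power2_eq_square sum_distrib_left mult.commute)
    also have "(\<Sum>a\<in>A. m * (\<Sum>b\<in>B. M a b)) = (N + 1) * m\<^sup>2"
      using row card by (simp add: N_def power2_eq_square)
    finally show ?thesis .
  qed
  \<comment> \<open>the coefficients solve the normal equations of the least-squares problem\<close>
  define T where "T a b c d = (N * (M a b + M c d) + M a d + M c b) / (N\<^sup>2 - 1) - m / (N * (N - 1))" for a b c d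
  have K: "N\<^sup>2 - 1 > 0" using N using power_mono[of 2 N 2] N by simp
  have T1: "(\<Sum>d\<in>B - {b}. T a b c d) = M a b" if "a \<in> A" "b \<in> B" "c \<in> A - {a}" for a b c
  proof -
    have cB: "real (card (B - {b})) = N" using that fin card n1 by simp
    have "(\<Sum>d\<in>B - {b}. T a b c d)
       = (N * (N * M a b + (\<Sum>d\<in>B-{b}. M c d)) + (\<Sum>d\<in>B-{b}. M a d) + N * M c b) / (N\<^sup>2 - 1) - N * (m / (N * (N - 1)))"
      unfolding T_def sum_subtractf sum_divide_distrib[symmetric] sum.distrib sum_distrib_left[symmetric]
      using cB by (simp add: that)
    also have "\<dots> = (N * (N * M a b + (m - M c b)) + (m - M a b) + N * M c b) / (N\<^sup>2 - 1) - N * (m / (N * (N - 1)))"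
      using row' that by simp
    also have "N * (N * M a b + (m - M c b)) + (m - M a b) + N * M c b = (N\<^sup>2 - 1) * M a b + (N + 1) * m"
      by (simp add: algebra_simps power2_eq_square)
    also have "\<dots> / (N\<^sup>2 - 1) - N * (m / (N * (N - 1))) = M a b"
    proof -
      have e: "N\<^sup>2 - 1 = (N + 1) * (N - 1)" by (simp add: algebra_simps power2_eq_square)
      have "(N + 1) * m / (N\<^sup>2 - 1) = m / (N - 1)" unfolding e using N by simp
      moreover have "N * (m / (N * (N - 1))) = m / (N - 1)" using N by simp
      ultimately show ?thesis using K by (simp add: add_divide_distrib)
    qed
    finally show ?thesis .
  qed
  have T_sym: "T a b c d = T c d a b" for a b c d by (simp add: T_def add.commute)
  have T2: "(\<Sum>b\<in>B - {d}. T a b c d) = M c d" if "a \<in> A" "c \<in> A - {a}" "d \<in> B" for a c d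
    using T1[of c d a] that by (subst T_sym) auto
  have DT: "D (\<lambda>a b c d. X a b c d * T a b c d) = 2 * W - m\<^sup>2"
    if X1: "\<And>a b c. a \<in> A \<Longrightarrow> b \<in> B \<Longrightarrow> c \<in> A - {a} \<Longrightarrow> (\<Sum>d\<in>B - {b}. X a b c d) = M a b"
    and X2: "\<And>a c d. a \<in> A \<Longrightarrow> c \<in> A - {a} \<Longrightarrow> d \<in> B \<Longrightarrow> (\<Sum>b\<in>B - {d}. X a b c d) = M c d" for X
  proof -
    have X2': "(\<Sum>b\<in>B - {d}. X a b c d) = M c d" if "c \<in> A" "a \<in> A - {c}" "d \<in> B" for a c d
      using X2[of a c d] that by auto
    have X1': "(\<Sum>d\<in>B - {b}. X a b c d) = M a b" if "c \<in> A" "a \<in> A - {c}" "b \<in> B" for a b c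
      using X1[of a b c] that by auto
    have cA: "real (card (A - {a})) = N" if "a \<in> A" for a using that fin card n1 by simp
    have e1: "D (\<lambda>a b c d. X a b c d * M a b) = N * W"
    proof -
      have "D (\<lambda>a b c d. X a b c d * M a b) = (\<Sum>a\<in>A. \<Sum>c\<in>A - {a}. \<Sum>b\<in>B. (M a b)\<^sup>2)"
        unfolding D_def sum_distrib_right[symmetric] by (simp add: X1 power2_eq_square)
      also have "\<dots> = N * W" using cA by (simp add: W_def sum_distrib_left)
      finally show ?thesis .
    qed
    have e2: "D (\<lambda>a b c d. X a b c d * M c d) = N * W"
    proof -
      have "D (\<lambda>a b c d. X a b c d * M c d)
          = (\<Sum>c\<in>A. \<Sum>a\<in>A - {c}. \<Sum>d\<in>B. \<Sum>b\<in>B - {d}. X a b c d * M c d)"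
        unfolding D_def by (subst sum_off_diagonal_swap[OF fin(1)], subst sum_off_diagonal_swap[OF fin(2)]) simp
      also have "\<dots> = (\<Sum>c\<in>A. \<Sum>a\<in>A - {c}. \<Sum>d\<in>B. (M c d)\<^sup>2)"
        unfolding sum_distrib_right[symmetric] by (simp add: X2' power2_eq_square)
      also have "\<dots> = N * W" using cA by (simp add: W_def sum_distrib_left)
      finally show ?thesis .
    qed
    have e3: "D (\<lambda>a b c d. X a b c d * M c b) = (N + 1) * m\<^sup>2 - W"
    proof -
      have "D (\<lambda>a b c d. X a b c d * M c b)
          = (\<Sum>c\<in>A. \<Sum>a\<in>A - {c}. \<Sum>b\<in>B. \<Sum>d\<in>B - {b}. X a b c d * M c b)"
        unfolding D_def by (subst sum_off_diagonal_swap[OF fin(1)]) simp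
      also have "\<dots> = (\<Sum>c\<in>A. \<Sum>a\<in>A - {c}. \<Sum>b\<in>B. M a b * M c b)"
        unfolding sum_distrib_right[symmetric] by (simp add: X1')
      also have "\<dots> = (\<Sum>c\<in>A. \<Sum>b\<in>B. (\<Sum>a\<in>A - {c}. M a b) * M c b)"
        by (subst sum.swap) (simp add: sum_distrib_right)
      also have "\<dots> = (\<Sum>c\<in>A. \<Sum>b\<in>B. M c b * (m - M c b))"
        by (simp add: col' mult.commute)
      finally show ?thesis using W2 by simp
    qed
    have e4: "D (\<lambda>a b c d. X a b c d * M a d) = (N + 1) * m\<^sup>2 - W"
    proof -
      have "D (\<lambda>a b c d. X a b c d * M a d)
          = (\<Sum>a\<in>A. \<Sum>c\<in>A - {a}. \<Sum>d\<in>B. \<Sum>b\<in>B - {d}. X a b c d * M a d)"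
        unfolding D_def by (subst sum_off_diagonal_swap[OF fin(2)]) simp
      also have "\<dots> = (\<Sum>a\<in>A. \<Sum>c\<in>A - {a}. \<Sum>d\<in>B. M c d * M a d)"
        unfolding sum_distrib_right[symmetric] by (simp add: X2)
      also have "\<dots> = (\<Sum>a\<in>A. \<Sum>d\<in>B. (\<Sum>c\<in>A - {a}. M c d) * M a d)"
        by (subst sum.swap) (simp add: sum_distrib_right)
      also have "\<dots> = (\<Sum>a\<in>A. \<Sum>d\<in>B. M a d * (m - M a d))"
        by (simp add: col' mult.commute)
      finally show ?thesis using W2 by simp
    qed
    have e5: "D X = N * (N + 1) * m"
    proof -
      have "D X = (\<Sum>a\<in>A. \<Sum>c\<in>A - {a}. \<Sum>b\<in>B. M a b)"
        unfolding D_def by (simp add: X1)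
      also have "\<dots> = N * (N + 1) * m" using cA row card by (simp add: N_def)
      finally show ?thesis .
    qed
    have "(\<lambda>a b c d. X a b c d * T a b c d) = (\<lambda>a b c d. N / (N\<^sup>2 - 1) * (X a b c d * M a b)
        + (N / (N\<^sup>2 - 1) * (X a b c d * M c d) + (1 / (N\<^sup>2 - 1) * (X a b c d * M a d)
        + (1 / (N\<^sup>2 - 1) * (X a b c d * M c b) + (- m / (N * (N - 1))) * X a b c d))))"
      by (simp add: T_def fun_eq_iff add_divide_distrib algebra_simps)
    then have "D (\<lambda>a b c d. X a b c d * T a b c d) = N / (N\<^sup>2 - 1) * (N * W)
        + (N / (N\<^sup>2 - 1) * (N * W) + (1 / (N\<^sup>2 - 1) * ((N + 1) * m\<^sup>2 - W)
        + (1 / (N\<^sup>2 - 1) * ((N + 1) * m\<^sup>2 - W) + (- m / (N * (N - 1))) * (N * (N + 1) * m))))"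
      by (simp only: D_add D_mult e1 e2 e3 e4 e5)
    also have "(- m / (N * (N - 1))) * (N * (N + 1) * m) = - ((N + 1) / (N - 1)) * m\<^sup>2"
      using N by (simp add: power2_eq_square)
    also have "N / (N\<^sup>2 - 1) * (N * W) + (N / (N\<^sup>2 - 1) * (N * W) + (1 / (N\<^sup>2 - 1) * ((N + 1) * m\<^sup>2 - W)
        + (1 / (N\<^sup>2 - 1) * ((N + 1) * m\<^sup>2 - W) + - ((N + 1) / (N - 1)) * m\<^sup>2)))
        = 2 * W * ((N\<^sup>2 - 1) / (N\<^sup>2 - 1)) + (2 * ((N + 1) / (N\<^sup>2 - 1)) - (N + 1) / (N - 1)) * m\<^sup>2"
      by (simp only: diff_divide_distrib power2_eq_square ring_distribs add_divide_distrib
          times_divide_eq_left times_divide_eq_right minus_divide_left) (simp add: algebra_simps)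
    also have "(N + 1) / (N\<^sup>2 - 1) = 1 / (N - 1)"
    proof -
      have e: "N\<^sup>2 - 1 = (N + 1) * (N - 1)" by (simp add: algebra_simps power2_eq_square)
      show ?thesis unfolding e using N by simp
    qed
    also have "2 * (1 / (N - 1)) - (N + 1) / (N - 1) = -1"
      using N by (simp add: diff_divide_distrib[symmetric] divide_eq_eq)
    finally show ?thesis using K by simp
  qed
  have DST: "D (\<lambda>a b c d. S a b c d * T a b c d) = 2 * W - m\<^sup>2"
    by (rule DT) (fact S1, fact S2)
  have DTT: "D (\<lambda>a b c d. T a b c d * T a b c d) = 2 * W - m\<^sup>2"
    by (rule DT) (fact T1, fact T2)
  have "0 \<le> D (\<lambda>a b c d. (S a b c d - T a b c d)\<^sup>2)"
    unfolding D_def by (intro sum_nonneg) simp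
  also have "(\<lambda>a b c d. (S a b c d - T a b c d)\<^sup>2)
      = (\<lambda>a b c d. (S a b c d)\<^sup>2 + ((-2) * (S a b c d * T a b c d) + T a b c d * T a b c d))"
    by (simp add: fun_eq_iff power2_eq_square algebra_simps)
  finally have "0 \<le> D (\<lambda>a b c d. (S a b c d)\<^sup>2) + ((-2) * (2 * W - m\<^sup>2) + (2 * W - m\<^sup>2))"
    by (simp only: D_add D_mult DST DTT)
  then have "2 * W - m\<^sup>2 \<le> D (\<lambda>a b c d. (S a b c d)\<^sup>2)" by simp
  also have "\<dots> = (\<Sum>a\<in>A. \<Sum>b\<in>B. \<Sum>c\<in>A - {a}. \<Sum>d\<in>B - {b}. (S a b c d)\<^sup>2)"
    unfolding D_def by (rule sum.cong[OF refl], rule sum.swap)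
  finally show ?thesis by (simp add: W_def)
qed


lemma bij_betw_remove_point:
  assumes "bij_betw g A B" "a \<in> A" "g a = b"
  shows "bij_betw g (A - {a}) (B - {b})"
  using assms by (auto simp: bij_betw_def inj_on_def)

lemma sum_fibres_point:
  assumes "finite G" "finite B" "\<And>g. g \<in> G \<Longrightarrow> bij_betw g A B" "a \<in> A"
  shows "(\<Sum>b\<in>B. sum v {g\<in>G. g a = b}) = sum v G"
  using assms by (intro sum.group) (auto simp: bij_betw_def)

lemma sum_fibres_value:
  assumes "finite G" "finite A" "\<And>g. g \<in> G \<Longrightarrow> bij_betw g A B" "b \<in> B"
  shows "(\<Sum>a\<in>A. sum v {g\<in>G. g a = b}) = sum v G"
proof -
  have "(\<Sum>a\<in>A. sum v {g\<in>G. inv_into A g b = a}) = sum v G"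
    using assms by (intro sum.group) (auto simp: bij_betw_def inv_into_into)
  moreover have "{g\<in>G. g a = b} = {g\<in>G. inv_into A g b = a}" if "a \<in> A" for a
    using that assms(3,4) by (auto simp: bij_betw_def f_inv_into_f)
  ultimately show ?thesis by simp
qed

text \<open>If \<open>G\<close> consists of all bijections, then equality holds for constants and for vectors of the
  standard representation.\<close>
lemma energy_base:
  assumes fin: "finite A" "finite B" "finite G" and card: "card A = card B" "card A \<ge> 3"
    and bij: "\<And>g. g \<in> G \<Longrightarrow> bij_betw g A B"
  shows "2 * energy 1 A G v \<le> energy 2 A G v + (sum v G)\<^sup>2"
proof -
  let ?M = "\<lambda>a b. sum v {g\<in>G. g a = b}"
  let ?S = "\<lambda>a b c d. sum v {g\<in>{g\<in>G. g a = b}. g c = d}"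
  have bij': "bij_betw g (A - {a}) (B - {b})" if "g \<in> {g\<in>G. g a = b}" "a \<in> A" for g a b
    using that bij bij_betw_remove_point by fastforce
  have val: "g a \<in> B" if "g \<in> G" "a \<in> A" for g a
    using bij that bij_betwE by blast
  have val': "g c \<in> B - {b}" if "g \<in> {g\<in>G. g a = b}" "a \<in> A" "c \<in> A - {a}" for g a b c
    using bij'[OF that(1,2)] that(3) bij_betwE by blast
  have one: "energy 1 A G v = (\<Sum>a\<in>A. \<Sum>b\<in>B. (?M a b)\<^sup>2)"
    using energy_Suc[of A B G 0 v] fin val by (simp add: energy_0)
  have "energy 2 A G v = (\<Sum>a\<in>A. \<Sum>b\<in>B. energy 1 (A - {a}) {g\<in>G. g a = b} v)"
    using energy_Suc[of A B G 1 v] fin val by (simp add: numeral_2_eq_2)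
  also have "\<dots> = (\<Sum>a\<in>A. \<Sum>b\<in>B. \<Sum>c\<in>A - {a}. \<Sum>d\<in>B - {b}. (?S a b c d)\<^sup>2)"
  proof (intro sum.cong refl)
    fix a b assume ab: "a \<in> A" "b \<in> B"
    have "energy (Suc 0) (A - {a}) {g\<in>G. g a = b} v
      = (\<Sum>c\<in>A - {a}. \<Sum>d\<in>B - {b}. energy 0 (A - {a} - {c}) {g\<in>{g\<in>G. g a = b}. g c = d} v)"
      by (rule energy_Suc) (use fin val' ab in auto)
    then show "energy 1 (A - {a}) {g\<in>G. g a = b} v = (\<Sum>c\<in>A - {a}. \<Sum>d\<in>B - {b}. (?S a b c d)\<^sup>2)"
      by (simp add: energy_0)
  qed
  finally have two: "energy 2 A G v = (\<Sum>a\<in>A. \<Sum>b\<in>B. \<Sum>c\<in>A - {a}. \<Sum>d\<in>B - {b}. (?S a b c d)\<^sup>2)" .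
  show ?thesis
    unfolding one two
  proof (rule pair_marginal_sq_sum[OF fin(1,2) refl card(1)[symmetric] card(2)])
    show "(\<Sum>b\<in>B. ?M a b) = sum v G" if "a \<in> A" for a
      by (rule sum_fibres_point[OF fin(3,2) bij that])
    show "(\<Sum>a\<in>A. ?M a b) = sum v G" if "b \<in> B" for b
      by (rule sum_fibres_value[OF fin(3,1) bij that])
    show "(\<Sum>d\<in>B - {b}. ?S a b c d) = ?M a b" if "a \<in> A" "b \<in> B" "c \<in> A - {a}" for a b c
      by (rule sum_fibres_point[of _ _ "A - {a}"]) (use fin bij' that in auto)
    show "(\<Sum>b\<in>B - {d}. ?S a b c d) = ?M c d" if "a \<in> A" "c \<in> A - {a}" "d \<in> B" for a c d
    proof -
      have "(\<Sum>b\<in>B - {d}. sum v {g\<in>{g\<in>G. g c = d}. g a = b}) = ?M c d"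
        by (rule sum_fibres_point[of _ _ "A - {c}"]) (use fin bij' that in auto)
      moreover have "{g\<in>{g\<in>G. g a = b}. g c = d} = {g\<in>{g\<in>G. g c = d}. g a = b}" for b by auto
      ultimately show ?thesis by simp
    qed
  qed
qed

text \<open>The square of the total sum accounts for the constant part of \<open>v\<close>, so that the induction
  hypothesis applies to the sets \<open>{g \<in> G. g a = b}\<close>, on which the sum of \<open>v\<close> is arbitrary. Summing the hypothesis over \<open>a\<close> and \<open>b\<close> bounds \<open>(i + 2) E\<^sub>i\<^sub>+\<^sub>2\<close> by
  \<open>(i + 1) E\<^sub>i\<^sub>+\<^sub>3 + E\<^sub>1\<close>, and the second inequality turns \<open>E\<^sub>1\<close> into a multiple of \<open>E\<^sub>i\<^sub>+\<^sub>2\<close>.\<close>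
lemma energy_growth:
  assumes "finite A" "finite B" "finite G" "card A = card B"
    and "\<And>g. g \<in> G \<Longrightarrow> bij_betw g A B" and "Suc i + 2 \<le> card A"
  shows "real (i + 2) * energy (Suc i) A G v \<le> real (Suc i) * energy (Suc (Suc i)) A G v + (sum v G)\<^sup>2
    \<and> real (Suc i) * (energy 1 A G v - (sum v G)\<^sup>2) \<le> energy (Suc i) A G v - (sum v G)\<^sup>2"
  using assms
proof (induction i arbitrary: A B G)
  case 0
  then show ?case using energy_base[of A B G v] by (simp add: numeral_2_eq_2)
next
  case (Suc i)
  let ?m = "(sum v G)\<^sup>2"
  let ?E = "\<lambda>i. energy i A G v"
  have val: "g a \<in> B" if "g \<in> G" "a \<in> A" for g a
    using Suc.prems(5) that bij_betwE by blast
  have IH: "real (i + 2) * ?E (Suc i) \<le> real (Suc i) * ?E (Suc (Suc i)) + ?m"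
      "real (Suc i) * (?E 1 - ?m) \<le> ?E (Suc i) - ?m"
    using Suc.IH[of A B G] Suc.prems by auto
  have rec: "?E (Suc j) = (\<Sum>a\<in>A. \<Sum>b\<in>B. energy j (A - {a}) {g\<in>G. g a = b} v)" for j
    by (rule energy_Suc) (use Suc.prems val in auto)
  have c: "real (Suc (Suc i)) * (?E 1 - ?m) \<le> ?E (Suc (Suc i)) - ?m"
  proof -
    have "real (Suc i) * (real (i + 2) * (?E 1 - ?m)) = real (i + 2) * (real (Suc i) * (?E 1 - ?m))"
      by (simp only: mult.left_commute)
    also have "\<dots> \<le> real (i + 2) * (?E (Suc i) - ?m)"
      by (rule mult_left_mono) (use IH in auto)
    also have "\<dots> \<le> real (Suc i) * (?E (Suc (Suc i)) - ?m)"
      using IH(1) by (simp add: algebra_simps)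
    finally show ?thesis by (simp add: mult_le_cancel_left_pos)
  qed
  have "real (i + 2) * ?E (Suc (Suc i)) \<le> real (Suc i) * ?E (Suc (Suc (Suc i))) + ?E 1"
  proof -
    have "real (i + 2) * ?E (Suc (Suc i))
        = (\<Sum>a\<in>A. \<Sum>b\<in>B. real (i + 2) * energy (Suc i) (A - {a}) {g\<in>G. g a = b} v)"
      unfolding rec[of "Suc i"] by (simp only: sum_distrib_left)
    also have "\<dots> \<le> (\<Sum>a\<in>A. \<Sum>b\<in>B. real (Suc i) * energy (Suc (Suc i)) (A - {a}) {g\<in>G. g a = b} v
        + (sum v {g\<in>G. g a = b})\<^sup>2)"
    proof (intro sum_mono)
      fix a b assume ab: "a \<in> A" "b \<in> B"
      show "real (i + 2) * energy (Suc i) (A - {a}) {g\<in>G. g a = b} v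
        \<le> real (Suc i) * energy (Suc (Suc i)) (A - {a}) {g\<in>G. g a = b} v + (sum v {g\<in>G. g a = b})\<^sup>2"
        by (rule Suc.IH[where B = "B - {b}", THEN conjunct1])
          (use Suc.prems ab in \<open>auto intro: bij_betw_remove_point\<close>)
    qed
    also have "\<dots> = real (Suc i) * ?E (Suc (Suc (Suc i))) + ?E 1"
      unfolding rec[of "Suc (Suc i)"] using rec[of 0]
      by (simp only: sum.distrib sum_distrib_left energy_0 One_nat_def)
    finally show ?thesis .
  qed
  then have "real (i + 2) * (?E (Suc (Suc i)) - ?m) \<le> real (Suc i) * (?E (Suc (Suc (Suc i))) - ?m) + (?E 1 - ?m)"
    by (simp add: algebra_simps)
  then have "real (i + 2) * (real (i + 2) * (?E (Suc (Suc i)) - ?m))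
      \<le> real (i + 2) * (real (Suc i) * (?E (Suc (Suc (Suc i))) - ?m) + (?E 1 - ?m))"
    by (rule mult_left_mono) simp
  also have "\<dots> \<le> real (i + 2) * (real (Suc i) * (?E (Suc (Suc (Suc i))) - ?m)) + (?E (Suc (Suc i)) - ?m)"
    using c by (simp add: distrib_left)
  finally have "real (Suc i) * (real (i + 3) * (?E (Suc (Suc i)) - ?m))
      \<le> real (Suc i) * (real (i + 2) * (?E (Suc (Suc (Suc i))) - ?m))"
    by (simp add: algebra_simps)
  then have "real (i + 3) * (?E (Suc (Suc i)) - ?m) \<le> real (i + 2) * (?E (Suc (Suc (Suc i))) - ?m)"
    by (simp only: mult_le_cancel_left_pos of_nat_0_less_iff zero_less_Suc)
  with c show ?case by (simp add: algebra_simps)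
qed

lemma energy_ratio_mono:
  assumes "finite A" "finite B" "finite G" "card A = card B"
    and "\<And>g. g \<in> G \<Longrightarrow> bij_betw g A B" and "i \<ge> 1" "i + 2 \<le> card A" and "sum v G = 0"
  shows "energy i A G v / real i \<le> energy (Suc i) A G v / real (Suc i)"
proof -
  obtain j where "i = Suc j" using \<open>i \<ge> 1\<close> by (cases i) auto
  then have "real (Suc i) * energy i A G v \<le> real i * energy (Suc i) A G v"
    using energy_growth[of A B G j v] assms by auto
  with assms(6) show ?thesis by (simp add: field_simps)
qed


section \<open>The agreement form on functions of sum zero\<close>

lemma alternating_sum_bounds:
  fixes a :: "nat \<Rightarrow> real"
  assumes "\<And>l. l < L \<Longrightarrow> a (Suc l) \<le> a l" "0 \<le> a L"
  shows "0 \<le> (\<Sum>l\<le>L. (-1) ^ l * a l) \<and> (\<Sum>l\<le>L. (-1) ^ l * a l) \<le> a 0"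
  using assms
proof (induction L arbitrary: a)
  case (Suc L)
  have "0 \<le> (\<Sum>l\<le>L. (-1) ^ l * a (Suc l)) \<and> (\<Sum>l\<le>L. (-1) ^ l * a (Suc l)) \<le> a (Suc 0)"
    by (rule Suc.IH) (use Suc.prems in auto)
  moreover have "(\<Sum>l\<le>Suc L. (-1) ^ l * a l) = a 0 - (\<Sum>l\<le>L. (-1) ^ l * a (Suc l))"
    by (simp add: sum.atMost_Suc_shift sum_negf del: sum.atMost_Suc)
  moreover have "a (Suc 0) \<le> a 0" using Suc.prems by auto
  ultimately show ?case by linarith
qed auto

lemma alternating_exp_sum_nonneg:
  fixes h :: "nat \<Rightarrow> real"
  assumes dec: "\<And>l. l < L \<Longrightarrow> h (Suc l) \<le> h l" and nonneg: "0 \<le> h L"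
  shows "0 \<le> (\<Sum>l\<le>L. (-1) ^ l / fact l * h l)"
proof -
  have "0 \<le> h l" if "l \<le> L" for l
    using that nonneg dec by (induction rule: inc_induct) (auto intro: order.trans)
  then have "h (Suc l) / fact (Suc l) \<le> h l / fact l" if "l < L" for l
    using that dec[of l] fact_mono[of l "Suc l", where 'a = real]
    by (intro frac_le) auto
  then have "0 \<le> (\<Sum>l\<le>L. (-1) ^ l * (h l / fact l))"
    using alternating_sum_bounds[of L "\<lambda>l. h l / fact l"] nonneg by auto
  then show ?thesis by simp
qed

text \<open>By Pascal's rule, raising \<open>f\<close> by one changes the sum by \<open>f choose (j - 1)\<close> times an alternating
  sum of a complete row of binomial coefficients, which is zero.\<close>
lemma threshold_alternating_binomial:
  assumes "j \<ge> 1" "j \<le> f" "f \<le> j + L"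
  shows "(\<Sum>l\<le>L. (-1) ^ l * real ((j + l - 1) choose l) * real (f choose (j + l))) = 1"
  using assms(2,3)
proof (induction f rule: dec_induct)
  case base
  have "(\<Sum>l\<le>L. (-1) ^ l * real ((j + l - 1) choose l) * real (j choose (j + l)))
      = (\<Sum>l\<le>L. if l = 0 then 1 else 0)"
    by (intro sum.cong) auto
  then show ?case by simp
next
  case (step f)
  have "(\<Sum>l\<le>L. (-1) ^ l * real ((j + l - 1) choose l) * real (f choose (j + l - 1)))
      = (\<Sum>l\<le>L. real (f choose (j - 1)) * ((-1) ^ l * real ((f - (j - 1)) choose l)))"
  proof (intro sum.cong refl)
    fix l
    show "(-1) ^ l * real ((j + l - 1) choose l) * real (f choose (j + l - 1))
        = real (f choose (j - 1)) * ((-1) ^ l * real ((f - (j - 1)) choose l))"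
    proof (cases "j + l - 1 \<le> f")
      case True
      have "((j + l - 1) choose l) = ((j + l - 1) choose (j - 1))"
        using binomial_symmetric[of l "j + l - 1"] assms(1) by simp
      moreover have "(f choose (j + l - 1)) * ((j + l - 1) choose (j - 1)) = (f choose (j - 1)) * ((f - (j - 1)) choose l)"
        using choose_mult[of "j - 1" "j + l - 1" f] True assms(1) by simp
      ultimately have "((j + l - 1) choose l) * (f choose (j + l - 1)) = (f choose (j - 1)) * ((f - (j - 1)) choose l)"
        by (simp add: mult.commute)
      then have "real ((j + l - 1) choose l) * real (f choose (j + l - 1)) = real (f choose (j - 1)) * real ((f - (j - 1)) choose l)"
        by (metis of_nat_mult)
      then show ?thesis by (simp add: mult.assoc mult.left_commute)
    next
      case False
      then show ?thesis using step.hyps by (simp add: binomial_eq_0)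
    qed
  qed
  also have "\<dots> = real (f choose (j - 1)) * (\<Sum>l\<le>f - (j - 1). (-1) ^ l * real ((f - (j - 1)) choose l))"
    unfolding sum_distrib_left[symmetric] using step.prems assms(1) step.hyps
    by (intro arg_cong2[where f = "(*)"] refl sum.mono_neutral_right) (auto simp: binomial_eq_0)
  also have "\<dots> = 0"
    using choose_alternating_sum[of "f - (j - 1)", where 'a = real] step.hyps assms(1) by simp
  finally have zero: "(\<Sum>l\<le>L. (-1) ^ l * real ((j + l - 1) choose l) * real (f choose (j + l - 1))) = 0" .
  have "real (Suc f choose (j + l)) = real (f choose (j + l - 1)) + real (f choose (j + l))" for l
    using assms(1) by (cases "j + l") auto
  then have "(\<Sum>l\<le>L. (-1) ^ l * real ((j + l - 1) choose l) * real (Suc f choose (j + l)))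
     = (\<Sum>l\<le>L. (-1) ^ l * real ((j + l - 1) choose l) * real (f choose (j + l - 1)))
     + (\<Sum>l\<le>L. (-1) ^ l * real ((j + l - 1) choose l) * real (f choose (j + l)))"
    by (simp add: distrib_left sum.distrib)
  with zero step show ?case by simp
qed

text \<open>Inclusion-exclusion for the event that at least \<open>j\<close> of \<open>f\<close> agreements occur, written with
  falling factorials so that applying it to each entry of the kernel produces the ratios of energy and
  index.\<close>
lemma threshold_expansion:
  assumes "j \<ge> 1" "j \<le> n" "f \<le> n"
  shows "(\<Sum>l\<le>n - j. (-1) ^ l / fact l * (fact (j + l) * real (f choose (j + l)) / real (j + l)))
    = fact (j - 1) * of_bool (j \<le> f)"
proof (cases "j \<le> f")
  case True
  have "(-1) ^ l / fact l * (fact (j + l) * real (f choose (j + l)) / real (j + l))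
      = fact (j - 1) * ((-1) ^ l * real ((j + l - 1) choose l) * real (f choose (j + l)))" for l
  proof -
    have "(fact (j + l) :: real) = real (j + l) * fact (j + l - 1)"
      using assms(1) by (subst fact_reduce) auto
    moreover have "(fact (j + l - 1) :: real) = fact l * fact (j - 1) * real ((j + l - 1) choose l)"
      using binomial_fact_lemma[of l "j + l - 1"] assms(1)
      by (metis (no_types, lifting) Nat.add_diff_assoc2 diff_add_inverse2 le_add2 of_nat_fact of_nat_mult)
    ultimately show ?thesis using assms(1) by simp
  qed
  then show ?thesis
    using threshold_alternating_binomial[OF assms(1) True, of "n - j"] assms True
    by (simp add: sum_distrib_left[symmetric])
qed (simp add: binomial_eq_0)

text \<open>Double counting of pairs of a permutation and a set of \<open>i\<close> of its fixed points: the number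
  of fixed points has the factorial moments of a Poisson variable of mean 1, up to order \<open>n\<close>.\<close>
lemma sum_falling_fixed_points:
  assumes "i \<le> n"
  shows "(\<Sum>\<sigma> | \<sigma> permutes {1..n}. fact i * real (agreement {1..n} \<sigma> id choose i)) = fact n"
proof -
  let ?P = "{\<sigma>. \<sigma> permutes {1..n}}" and ?I = "{I. I \<subseteq> {1..n} \<and> card I = i}"
  have "real (agreement {1..n} \<sigma> id choose i) = (\<Sum>I\<in>?I. of_bool (\<forall>x\<in>I. \<sigma> x = x))" for \<sigma>
  proof -
    have "(agreement {1..n} \<sigma> id choose i) = card {I. I \<subseteq> {x\<in>{1..n}. \<sigma> x = id x} \<and> card I = i}"
      unfolding agreement_def by (rule n_subsets[symmetric]) simp
    also have "{I. I \<subseteq> {x\<in>{1..n}. \<sigma> x = id x} \<and> card I = i} = ?I \<inter> {I. \<forall>x\<in>I. \<sigma> x = x}"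
      by auto
    finally show ?thesis by (simp add: sum_of_bool_eq id_def)
  qed
  then have "(\<Sum>\<sigma>\<in>?P. real (agreement {1..n} \<sigma> id choose i)) = (\<Sum>I\<in>?I. \<Sum>\<sigma>\<in>?P. of_bool (\<forall>x\<in>I. \<sigma> x = x))"
    by (simp only: sum.swap[of _ ?I])
  also have "\<dots> = (\<Sum>I\<in>?I. fact (n - i))"
  proof (intro sum.cong refl)
    fix I assume I: "I \<in> ?I"
    have "?P \<inter> {\<sigma>. \<forall>x\<in>I. \<sigma> x = x} = {\<sigma>. \<sigma> permutes ({1..n} - I)}"
      using I by (auto simp: permutes_def)
    moreover have "card {\<sigma>. \<sigma> permutes ({1..n} - I)} = fact (n - i)"
      using I by (intro card_permutations) (auto simp: card_Diff_subset finite_subset)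
    ultimately show "(\<Sum>\<sigma>\<in>?P. of_bool (\<forall>x\<in>I. \<sigma> x = x)) = (fact (n - i) :: real)"
      by (simp add: sum_of_bool_eq finite_permutations)
  qed
  also have "\<dots> = real (n choose i) * fact (n - i)"
    by (simp add: n_subsets)
  finally have "(\<Sum>\<sigma>\<in>?P. real (agreement {1..n} \<sigma> id choose i)) = real (n choose i) * fact (n - i)" .
  then have "(\<Sum>\<sigma>\<in>?P. fact i * real (agreement {1..n} \<sigma> id choose i)) = fact i * fact (n - i) * real (n choose i)"
    by (simp add: sum_distrib_left[symmetric])
  also have "\<dots> = fact n" using binomial_fact_lemma[OF assms] by (metis of_nat_fact of_nat_mult)
  finally show ?thesis .
qed

text \<open>The factor \<open>agreement - 1\<close> is the character of the standard representation, so this is the trace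
  of the class function behind \<open>E\<^sub>i / i\<close> on it. The exceptional value at \<open>i = n\<close> comes from the
  vanishing of the factorial moment of order \<open>n + 1\<close>.\<close>
lemma sum_falling_fixed_points_std:
  assumes "i \<ge> 1" "i \<le> n"
  shows "(\<Sum>\<sigma> | \<sigma> permutes {1..n}. fact i * real (agreement {1..n} \<sigma> id choose i) / real i
      * (real (agreement {1..n} \<sigma> id) - 1)) = fact n * (if i < n then 1 else (real n - 1) / real n)"
proof -
  let ?P = "{\<sigma>. \<sigma> permutes {1..n}}" and ?f = "\<lambda>\<sigma>. agreement {1..n} \<sigma> id"
  let ?F = "\<lambda>i \<sigma>. fact i * real (?f \<sigma> choose i)"
  have le: "?f \<sigma> \<le> n" for \<sigma>
    using agreement_le[of "{1..n}" \<sigma> id] by simp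
  have nxt: "(\<Sum>\<sigma>\<in>?P. ?F (Suc i) \<sigma>) = (if i < n then fact n else 0)"
  proof (cases "i < n")
    case False
    then have "?F (Suc i) \<sigma> = 0" for \<sigma>
      using le[of \<sigma>] binomial_eq_0[of "?f \<sigma>" "Suc i"] by simp
    then have "(\<Sum>\<sigma>\<in>?P. ?F (Suc i) \<sigma>) = 0" by (intro sum.neutral ballI)
    with False show ?thesis by simp
  qed (use sum_falling_fixed_points[of "Suc i" n] in simp)
  have "?F i \<sigma> / real i * (real (?f \<sigma>) - 1) = (?F (Suc i) \<sigma> + (real i - 1) * ?F i \<sigma>) / real i" for \<sigma>
  proof -
    let ?m = "?f \<sigma>"
    have "real (?m choose i) * (real ?m - real i) = real (Suc i) * real (?m choose Suc i)"
    proof (cases "i \<le> ?m")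
      case True
      then show ?thesis using binomial_absorb_comp[of ?m i] binomial_absorption[of i ?m]
        by (metis of_nat_diff of_nat_mult mult.commute)
    qed (simp add: binomial_eq_0)
    then have "fact i * (real (?m choose i) * (real ?m - real i)) = ?F (Suc i) \<sigma>"
      by (simp add: algebra_simps)
    then have "?F (Suc i) \<sigma> + (real i - 1) * ?F i \<sigma> = ?F i \<sigma> * (real ?m - 1)"
      by (simp add: algebra_simps)
    then show ?thesis by simp
  qed
  then have "(\<Sum>\<sigma>\<in>?P. ?F i \<sigma> / real i * (real (?f \<sigma>) - 1))
      = ((\<Sum>\<sigma>\<in>?P. ?F (Suc i) \<sigma>) + (real i - 1) * (\<Sum>\<sigma>\<in>?P. ?F i \<sigma>)) / real i"
    by (simp only: sum_divide_distrib[symmetric] sum.distrib sum_distrib_left)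
  also have "\<dots> = fact n * (if i < n then 1 else (real n - 1) / real n)"
    unfolding nxt sum_falling_fixed_points[OF assms(2)] using assms by (simp add: field_simps)
  finally show ?thesis .
qed

text \<open>If \<open>g\<close> and \<open>h\<close> differ at \<open>x\<close>, they also differ at the point which \<open>g\<close> sends to \<open>h x\<close>.\<close>
lemma agreement_permutes_distinct:
  assumes "finite A" "g permutes A" "h permutes A" "g \<noteq> h"
  shows "agreement A g h + 2 \<le> card A"
proof -
  obtain x where x: "g x \<noteq> h x" using assms(4) by auto
  then have xA: "x \<in> A" using assms(2,3) by (metis permutes_not_in)
  obtain y where y: "g y = h x" using assms(2) by (metis permutes_surj surjE)
  then have yA: "y \<in> A" using xA assms(2,3) by (metis permutes_in_image)
  have yx: "y \<noteq> x" "g y \<noteq> h y" using x y assms(3) by (auto dest: permutes_inj simp: inj_eq)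
  have "agreement A g h \<le> card (A - {x, y})"
    unfolding agreement_def using x yx assms(1) by (intro card_mono) auto
  moreover have "card (A - {x, y}) + 2 = card A"
    using xA yA yx assms(1) card_mono[of A "{x, y}"] by (subst card_Diff_subset) auto
  ultimately show ?thesis by simp
qed

text \<open>Distinct permutations agree in at most \<open>n - 2\<close> points, so only the diagonal terms remain.\<close>
lemma energy_permutes_top:
  assumes "i \<le> n" "n \<le> Suc i"
  shows "energy i {1..n} {p. p permutes {1..n}} v = fact n * (\<Sum>g | g permutes {1..n}. (v g)\<^sup>2)"
proof -
  let ?P = "{p. p permutes {1..n}}"
  have "fact i * real (agreement {1..n} g h choose i) = (if h = g then fact n else 0)"
    if "g \<in> ?P" "h \<in> ?P" for g h
  proof (cases "g = h")
    case True
    then have "agreement {1..n} g h = n" by (simp add: agreement_self)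
    moreover have "i = n \<or> n = Suc i" using assms by auto
    ultimately show ?thesis using True by auto
  next
    case False
    then have "agreement {1..n} g h < i"
      using agreement_permutes_distinct[of "{1..n}" g h] that assms by auto
    then show ?thesis using False by (simp add: binomial_eq_0)
  qed
  then have "energy i {1..n} ?P v = (\<Sum>g\<in>?P. \<Sum>h\<in>?P. if h = g then fact n * (v g)\<^sup>2 else 0)"
    unfolding energy_def by (intro sum.cong refl) (auto simp: power2_eq_square)
  then show ?thesis by (simp add: sum_distrib_left finite_permutations)
qed

text \<open>The gap between the two sides is a positive multiple of \<open>\<Sum>\<^sub>l (-1)\<^sup>l / l! \<cdot> H (j + l)\<close>, where \<open>H i\<close> is
  the amount by which \<open>E\<^sub>i / i\<close> falls short of its value for a vector of the standard representation
  of the same norm.\<close>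
lemma agreement_form_bound:
  assumes n: "n \<ge> 3" and j: "j + 2 \<le> n" and v: "(\<Sum>g | g permutes {1..n}. v g) = 0"
  shows "(\<Sum>g | g permutes {1..n}. \<Sum>h | h permutes {1..n}. v g * v h * of_bool (j \<le> agreement {1..n} g h))
    \<le> (\<Sum>\<sigma> | \<sigma> permutes {1..n}. of_bool (j \<le> agreement {1..n} \<sigma> id) * (real (agreement {1..n} \<sigma> id) - 1))
        / (real n - 1) * (\<Sum>g | g permutes {1..n}. (v g)\<^sup>2)"
proof -
  let ?P = "{p. p permutes {1..n}}" and ?ag = "agreement {1..n}"
  have P: "finite ?P" by (simp add: finite_permutations)
  have bij: "bij_betw g {1..n} {1..n}" if "g \<in> ?P" for g
    using that by (simp add: permutes_imp_bij)
  define V where "V = (\<Sum>g\<in>?P. (v g)\<^sup>2)"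
  have V: "V \<ge> 0" unfolding V_def by (intro sum_nonneg) simp
  define E where "E i = energy i {1..n} ?P v / real i" for i
  \<comment> \<open>\<open>fact n * e i / (real n - 1)\<close> is the value of \<open>E i\<close> on unit vectors of the standard representation\<close>
  define e where "e i = (if i < n then 1 else (real n - 1) / real n)" for i
  show ?thesis
  proof (cases "j = 0")
    case True
    have "(\<Sum>g\<in>?P. \<Sum>h\<in>?P. v g * v h) = 0"
      using v by (simp add: sum_product[symmetric])
    moreover have "(\<Sum>\<sigma>\<in>?P. real (?ag \<sigma> id) - 1) = 0"
      using sum_falling_fixed_points[of 1 n] sum_falling_fixed_points[of 0 n] n
      by (simp add: sum_subtractf)
    ultimately show ?thesis using True by simp
  next
    case False
    then have j1: "j \<ge> 1" by simp
    have "fact (j - 1) * (\<Sum>g\<in>?P. \<Sum>h\<in>?P. v g * v h * of_bool (j \<le> ?ag g h))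
        = (\<Sum>g\<in>?P. \<Sum>h\<in>?P. v g * v h * (\<Sum>l\<le>n - j. (-1) ^ l / fact l *
             (fact (j + l) * real (?ag g h choose (j + l)) / real (j + l))))"
      using j j1 agreement_le[of "{1..n}"]
      by (subst threshold_expansion) (auto simp: sum_distrib_left mult_ac)
    also have "\<dots> = (\<Sum>g\<in>?P. \<Sum>h\<in>?P. \<Sum>l\<le>n - j. (-1) ^ l / fact l *
             (v g * v h * (fact (j + l) * real (?ag g h choose (j + l))) / real (j + l)))"
      by (simp only: sum_distrib_left) (simp add: mult_ac)
    also have "\<dots> = (\<Sum>l\<le>n - j. \<Sum>g\<in>?P. \<Sum>h\<in>?P. (-1) ^ l / fact l *
             (v g * v h * (fact (j + l) * real (?ag g h choose (j + l))) / real (j + l)))"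
      by (subst (2) sum.swap, subst sum.swap) simp
    also have "\<dots> = (\<Sum>l\<le>n - j. (-1) ^ l / fact l * E (j + l))"
      by (simp only: E_def energy_def sum_distrib_left sum_divide_distrib)
    finally have lhs: "fact (j - 1) * (\<Sum>g\<in>?P. \<Sum>h\<in>?P. v g * v h * of_bool (j \<le> ?ag g h))
        = (\<Sum>l\<le>n - j. (-1) ^ l / fact l * E (j + l))" .
    have "fact (j - 1) * (\<Sum>\<sigma>\<in>?P. of_bool (j \<le> ?ag \<sigma> id) * (real (?ag \<sigma> id) - 1))
        = (\<Sum>\<sigma>\<in>?P. (\<Sum>l\<le>n - j. (-1) ^ l / fact l *
             (fact (j + l) * real (?ag \<sigma> id choose (j + l)) / real (j + l))) * (real (?ag \<sigma> id) - 1))"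
      using j j1 agreement_le[of "{1..n}"]
      by (subst threshold_expansion) (auto simp: sum_distrib_left mult_ac)
    also have "\<dots> = (\<Sum>l\<le>n - j. (-1) ^ l / fact l * (\<Sum>\<sigma>\<in>?P.
             fact (j + l) * real (?ag \<sigma> id choose (j + l)) / real (j + l) * (real (?ag \<sigma> id) - 1)))"
      by (simp only: sum_distrib_left sum_distrib_right mult.assoc) (rule sum.swap)
    also have "\<dots> = (\<Sum>l\<le>n - j. (-1) ^ l / fact l * (fact n * e (j + l)))"
      unfolding e_def using j j1 by (intro sum.cong refl arg_cong2[where f = "(*)"] sum_falling_fixed_points_std) auto
    finally have rhs: "fact (j - 1) * (\<Sum>\<sigma>\<in>?P. of_bool (j \<le> ?ag \<sigma> id) * (real (?ag \<sigma> id) - 1))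
        = (\<Sum>l\<le>n - j. (-1) ^ l / fact l * (fact n * e (j + l)))" .
    define H where "H i = fact n * e i / (real n - 1) * V - E i" for i
    have H_top: "H i = 0" if "i \<le> n" "n \<le> Suc i" for i
    proof -
      have "i = n \<or> i = n - 1" using that by auto
      then show ?thesis
        unfolding H_def E_def energy_permutes_top[OF that] V_def[symmetric] e_def
        using n by (auto simp: of_nat_diff)
    qed
    have H_dec: "H (Suc i) \<le> H i" if "1 \<le> i" "i < n" for i
    proof (cases "i + 2 \<le> n")
      case True
      then have "E i \<le> E (Suc i)"
        unfolding E_def using energy_ratio_mono[of "{1..n}" "{1..n}" ?P i v] P bij that v by auto
      then show ?thesis using True by (simp add: H_def e_def)
    next
      case False
      then show ?thesis using H_top[of i] H_top[of "Suc i"] that by simp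
    qed
    have "0 \<le> (\<Sum>l\<le>n - j. (-1) ^ l / fact l * H (j + l))"
    proof (rule alternating_exp_sum_nonneg)
      show "H (j + Suc l) \<le> H (j + l)" if "l < n - j" for l using H_dec[of "j + l"] j1 that by simp
      show "0 \<le> H (j + (n - j))" using H_top[of n] j by simp
    qed
    also have "\<dots> = (\<Sum>l\<le>n - j. (-1) ^ l / fact l * (fact n * e (j + l)) / (real n - 1) * V
        - (-1) ^ l / fact l * E (j + l))"
      by (intro sum.cong refl) (simp add: H_def right_diff_distrib)
    also have "\<dots> = (\<Sum>l\<le>n - j. (-1) ^ l / fact l * (fact n * e (j + l))) / (real n - 1) * V
        - (\<Sum>l\<le>n - j. (-1) ^ l / fact l * E (j + l))"
      by (simp only: sum_subtractf sum_divide_distrib sum_distrib_right)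
    also have "\<dots> = fact (j - 1) * ((\<Sum>\<sigma>\<in>?P. of_bool (j \<le> ?ag \<sigma> id) * (real (?ag \<sigma> id) - 1)) / (real n - 1) * V
        - (\<Sum>g\<in>?P. \<Sum>h\<in>?P. v g * v h * of_bool (j \<le> ?ag g h)))"
      unfolding lhs[symmetric] rhs[symmetric] by (simp add: right_diff_distrib)
    finally have "fact (j - 1) * 0 \<le> fact (j - 1) * ((\<Sum>\<sigma>\<in>?P. of_bool (j \<le> ?ag \<sigma> id) * (real (?ag \<sigma> id) - 1)) / (real n - 1) * V
        - (\<Sum>g\<in>?P. \<Sum>h\<in>?P. v g * v h * of_bool (j \<le> ?ag g h)))"
      by simp
    then show ?thesis
      unfolding V_def by (simp only: mult_le_cancel_left_pos fact_gt_zero diff_ge_0_iff_ge)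
  qed
qed


section \<open>Second eigenvalue of a matrix with constant row and column sums\<close>

text \<open>The vector of all ones is an eigenvector. Completing it by unit vectors to a basis makes the
  matrix block triangular, and the second block is the action on the quotient by the constant
  vectors.\<close>
lemma char_poly_constant_row_sum:
  fixes A :: "complex mat"
  assumes A: "A \<in> carrier_mat (Suc m) (Suc m)"
    and row: "\<And>i. i < Suc m \<Longrightarrow> (\<Sum>j<Suc m. A $$ (i, j)) = d"
  shows "char_poly A = [:- d, 1:] * char_poly (mat m m (\<lambda>(i, j). A $$ (Suc i, Suc j) - A $$ (0, Suc j)))"
proof -
  let ?n = "Suc m"
  define C where "C = mat m m (\<lambda>(i, j). A $$ (Suc i, Suc j) - A $$ (0, Suc j))"
  \<comment> \<open>\<open>P\<close> is the change of basis and \<open>Q\<close> its inverse\<close>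
  define P :: "complex mat" where "P = mat ?n ?n (\<lambda>(i, j). if i = j \<or> j = 0 then 1 else 0)"
  define Q :: "complex mat" where "Q = mat ?n ?n (\<lambda>(i, j). if i = j then 1 else if j = 0 then -1 else 0)"
  define A1 :: "complex mat" where "A1 = mat 1 1 (\<lambda>_. d)"
  define A2 :: "complex mat" where "A2 = mat 1 m (\<lambda>(i, j). A $$ (0, Suc j))"
  define B where "B = four_block_mat A1 A2 (0\<^sub>m m 1) C"
  have A1: "A1 \<in> carrier_mat 1 1" and A2: "A2 \<in> carrier_mat 1 m" and C: "C \<in> carrier_mat m m"
    by (auto simp: A1_def A2_def C_def)
  have P: "P \<in> carrier_mat ?n ?n" and Q: "Q \<in> carrier_mat ?n ?n" by (auto simp: P_def Q_def)
  have B: "B \<in> carrier_mat ?n ?n"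
    using four_block_carrier_mat[OF A1 C, of A2 "0\<^sub>m m 1"] by (simp add: B_def)
  have B_entry: "B $$ (i, j) = (if j = 0 then (if i = 0 then d else 0)
      else if i = 0 then A $$ (0, j) else A $$ (i, j) - A $$ (0, j))" if "i < ?n" "j < ?n" for i j
    using that by (cases i; cases j) (auto simp: B_def A1_def A2_def C_def)
  have QP: "Q * P = 1\<^sub>m ?n"
  proof (rule eq_matI)
    fix i j assume "i < dim_row (1\<^sub>m ?n :: complex mat)" "j < dim_col (1\<^sub>m ?n :: complex mat)"
    then have ij: "i < ?n" "j < ?n" by auto
    have "(Q * P) $$ (i, j) = (\<Sum>k = 0..<?n. Q $$ (i, k) * P $$ (k, j))"
      using ij P Q by (simp add: scalar_prod_def)
    also have "\<dots> = (\<Sum>k\<in>{0..<?n}. (if k = i then P $$ (i, j) else 0)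
        + (if k = 0 then (if i = 0 then 0 else - P $$ (0, j)) else 0))"
      using ij by (intro sum.cong) (auto simp: Q_def)
    also have "\<dots> = P $$ (i, j) + (if i = 0 then 0 else - P $$ (0, j))"
      using ij by (simp add: sum.distrib)
    also have "\<dots> = 1\<^sub>m ?n $$ (i, j)" using ij by (auto simp: P_def)
    finally show "(Q * P) $$ (i, j) = 1\<^sub>m ?n $$ (i, j)" .
  qed (auto simp: P_def Q_def)
  have PQ: "P * Q = 1\<^sub>m ?n"
    by (rule mat_mult_left_right_inverse[OF Q P QP])
  have "A * P = P * B"
  proof (rule eq_matI)
    fix i j assume "i < dim_row (P * B)" "j < dim_col (P * B)"
    then have ij: "i < ?n" "j < ?n" using P B by auto
    have "(A * P) $$ (i, j) = (\<Sum>k = 0..<?n. A $$ (i, k) * P $$ (k, j))"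
      using ij P A by (simp add: scalar_prod_def)
    also have "\<dots> = (if j = 0 then d else A $$ (i, j))"
    proof (cases "j = 0")
      case True
      then show ?thesis using ij row[of i] by (simp add: P_def lessThan_atLeast0)
    next
      case False
      then have "(\<Sum>k = 0..<?n. A $$ (i, k) * P $$ (k, j)) = (\<Sum>k = 0..<?n. if k = j then A $$ (i, j) else 0)"
        using ij by (intro sum.cong) (auto simp: P_def)
      then show ?thesis using False ij by simp
    qed
    finally have L: "(A * P) $$ (i, j) = (if j = 0 then d else A $$ (i, j))" .
    have "(P * B) $$ (i, j) = (\<Sum>k = 0..<?n. P $$ (i, k) * B $$ (k, j))"
      using ij P B by (simp add: scalar_prod_def)
    also have "\<dots> = (\<Sum>k\<in>{0..<?n}. (if k = i then B $$ (i, j) else 0)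
        + (if k = 0 then (if i = 0 then 0 else B $$ (0, j)) else 0))"
      using ij by (intro sum.cong) (auto simp: P_def)
    also have "\<dots> = B $$ (i, j) + (if i = 0 then 0 else B $$ (0, j))"
      using ij by (simp add: sum.distrib)
    also have "\<dots> = (if j = 0 then d else A $$ (i, j))"
      using ij by (simp add: B_entry)
    finally show "(A * P) $$ (i, j) = (P * B) $$ (i, j)" using L by simp
  qed (use A P B in auto)
  then have "A * P * Q = P * B * Q" by simp
  then have "A = P * B * Q"
    using A P Q PQ by (simp add: assoc_mult_mat[OF A P Q])
  then have "similar_mat A B"
    using A B P Q PQ QP by (intro similar_matI[of _ _ P Q ?n]) auto
  then have "char_poly A = char_poly B" by (rule char_poly_similar)
  also have "\<dots> = char_poly A1 * char_poly C"
    unfolding B_def by (rule char_poly_four_block_zeros_col[OF A1 A2 C])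
  also have "char_poly A1 = [:- d, 1:]"
    by (subst char_poly_upper_triangular[OF A1]) (auto simp: A1_def diag_mat_def)
  finally show ?thesis by (simp add: C_def)
qed

text \<open>An eigenvector of the quotient, extended by a zero, satisfies \<open>A w = z w + c\<close> with a constant
  vector \<open>c\<close>. Subtracting the mean of \<open>w\<close> keeps this form, and then the constant has to vanish because
  \<open>A\<close> preserves the vectors of sum zero. This also works if \<open>z = d\<close>.\<close>
lemma deflated_eigenvector_sum_zero:
  fixes A :: "complex mat"
  assumes row: "\<And>i. i < Suc m \<Longrightarrow> (\<Sum>j<Suc m. A $$ (i, j)) = d"
    and col: "\<And>j. j < Suc m \<Longrightarrow> (\<Sum>i<Suc m. A $$ (i, j)) = d"
    and ev: "eigenvalue (mat m m (\<lambda>(i, j). A $$ (Suc i, Suc j) - A $$ (0, Suc j))) z"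
  obtains x where "\<exists>i<Suc m. x i \<noteq> 0" "(\<Sum>i<Suc m. x i) = 0"
    "\<And>i. i < Suc m \<Longrightarrow> (\<Sum>j<Suc m. A $$ (i, j) * x j) = z * x i"
proof -
  let ?n = "Suc m"
  let ?C = "mat m m (\<lambda>(i, j). A $$ (Suc i, Suc j) - A $$ (0, Suc j))"
  obtain u where u: "u \<in> carrier_vec m" "u \<noteq> 0\<^sub>v m" "?C *\<^sub>v u = z \<cdot>\<^sub>v u"
    using ev by (auto simp: eigenvalue_def eigenvector_def)
  define w where "w i = (case i of 0 \<Rightarrow> 0 | Suc k \<Rightarrow> u $ k)" for i
  define t where "t = (\<Sum>i<?n. w i) / of_nat ?n"
  define x where "x i = w i - t" for i
  obtain k where k: "k < m" "u $ k \<noteq> 0"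
    using u(1,2) by (metis carrier_vecD eq_vecI index_zero_vec)
  have "\<exists>i<?n. x i \<noteq> 0"
  proof (rule ccontr)
    assume "\<not> ?thesis"
    then have "x 0 = 0" "x (Suc k) = 0" using k by auto
    then show False using k by (simp add: x_def w_def)
  qed
  moreover have x_sum: "(\<Sum>i<?n. x i) = 0"
    by (simp add: x_def t_def sum_subtractf del: sum.lessThan_Suc of_nat_Suc)
  moreover have "(\<Sum>j<?n. A $$ (i, j) * x j) = z * x i" if i: "i < ?n" for i
  proof -
    define y where "y i = (\<Sum>j<?n. A $$ (i, j) * w j)" for i
    have y: "y i = y 0 + z * w i" if "i < ?n" for i
    proof (cases i)
      case (Suc l)
      have "(?C *\<^sub>v u) $ l = z * u $ l"
        using u Suc that by simp
      moreover have "(?C *\<^sub>v u) $ l = (\<Sum>j<m. (A $$ (Suc l, Suc j) - A $$ (0, Suc j)) * u $ j)"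
        using u(1) Suc that by (simp add: scalar_prod_def lessThan_atLeast0)
      ultimately have "(\<Sum>j<m. (A $$ (Suc l, Suc j) - A $$ (0, Suc j)) * u $ j) = z * u $ l" by simp
      then show ?thesis
        by (simp add: y_def Suc w_def sum.lessThan_Suc_shift sum_subtractf left_diff_distrib algebra_simps
            del: sum.lessThan_Suc)
    qed (simp add: w_def)
    have Ax: "(\<Sum>j<?n. A $$ (i, j) * x j) = z * x i + (y 0 + z * t - d * t)" if "i < ?n" for i
    proof -
      have "(\<Sum>j<?n. A $$ (i, j) * x j) = y i - (\<Sum>j<?n. A $$ (i, j)) * t"
        by (simp add: x_def y_def right_diff_distrib sum_subtractf sum_distrib_right del: sum.lessThan_Suc)
      then show ?thesis using row[OF that] y[OF that] by (simp add: x_def algebra_simps del: sum.lessThan_Suc)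
    qed
    have "(\<Sum>i<?n. \<Sum>j<?n. A $$ (i, j) * x j) = (\<Sum>j<?n. (\<Sum>i<?n. A $$ (i, j)) * x j)"
      unfolding sum_distrib_right by (rule sum.swap)
    also have "\<dots> = d * (\<Sum>j<?n. x j)"
      unfolding sum_distrib_left by (intro sum.cong refl) (use col in auto)
    finally have "0 = (\<Sum>i<?n. \<Sum>j<?n. A $$ (i, j) * x j)" using x_sum by simp
    also have "\<dots> = (\<Sum>i<?n. z * x i + (y 0 + z * t - d * t))"
      using Ax by (intro sum.cong refl) simp
    also have "\<dots> = z * (\<Sum>i<?n. x i) + of_nat ?n * (y 0 + z * t - d * t)"
      by (simp add: sum.distrib sum_distrib_left del: sum.lessThan_Suc of_nat_Suc)
    finally have "y 0 + z * t - d * t = 0" using x_sum by (simp del: of_nat_Suc)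
    then show ?thesis using Ax[OF i] by simp
  qed
  ultimately show ?thesis using that by blast
qed

text \<open>The deflation accounts for the algebraic multiplicity of \<open>d\<close>: one copy of \<open>d\<close> is split off, and
  every other root of the characteristic polynomial has an eigenvector of sum zero.\<close>
lemma nth_eigenvalue_2_eqI:
  fixes A :: "complex mat" and d \<mu> :: real
  assumes A: "A \<in> carrier_mat N N" and N: "N > 0"
    and row: "\<And>i. i < N \<Longrightarrow> (\<Sum>j<N. A $$ (i, j)) = complex_of_real d"
    and col: "\<And>j. j < N \<Longrightarrow> (\<Sum>i<N. A $$ (i, j)) = complex_of_real d"
    and less: "\<mu> < d"
    and ev: "\<exists>i<N. x i \<noteq> 0" "\<And>i. i < N \<Longrightarrow> (\<Sum>j<N. A $$ (i, j) * x j) = complex_of_real \<mu> * x i"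
    and bound: "\<And>z y. \<exists>i<N. y i \<noteq> 0 \<Longrightarrow> (\<Sum>i<N. y i) = 0 \<Longrightarrow>
       (\<And>i. i < N \<Longrightarrow> (\<Sum>j<N. A $$ (i, j) * y j) = z * y i) \<Longrightarrow> Re z \<le> \<mu>"
  shows "nth_eigenvalue 2 A = \<mu>"
proof -
  obtain m where m: "N = Suc m" using N gr0_implies_Suc by blast
  define C where "C = mat m m (\<lambda>(i, j). A $$ (Suc i, Suc j) - A $$ (0, Suc j))"
  have C: "C \<in> carrier_mat m m" by (simp add: C_def)
  have cp: "char_poly A = [:- complex_of_real d, 1:] * char_poly C"
    unfolding C_def by (rule char_poly_constant_row_sum) (use A row m in auto)
  have C0: "char_poly C \<noteq> 0" using degree_monic_char_poly[OF C] by auto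
  have roots: "proots (char_poly A) = {#complex_of_real d#} + proots (char_poly C)"
    unfolding cp using C0 by (subst proots_mult) auto
  have le: "Re z \<le> \<mu>" if "z \<in># proots (char_poly C)" for z
  proof -
    have "eigenvalue C z" using that C0 eigenvalue_root_char_poly[OF C] by simp
    then obtain y where "\<exists>i<N. y i \<noteq> 0" "(\<Sum>i<N. y i) = 0"
      "\<And>i. i < N \<Longrightarrow> (\<Sum>j<N. A $$ (i, j) * y j) = z * y i"
      using deflated_eigenvector_sum_zero[of m A "complex_of_real d" z] row col unfolding C_def m by blast
    then show ?thesis by (rule bound)
  qed
  have "eigenvalue A (complex_of_real \<mu>)"
  proof -
    have "vec N x \<noteq> 0\<^sub>v N" using ev(1) by (metis index_vec index_zero_vec(1))
    moreover have "A *\<^sub>v vec N x = complex_of_real \<mu> \<cdot>\<^sub>v vec N x"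
      using A ev(2) by (intro eq_vecI) (auto simp: scalar_prod_def lessThan_atLeast0)
    ultimately show ?thesis
      unfolding eigenvalue_def eigenvector_def using A by (intro exI[of _ "vec N x"]) auto
  qed
  then have "poly (char_poly C) (complex_of_real \<mu>) = 0"
    using less unfolding eigenvalue_root_char_poly[OF A] cp by auto
  then have \<mu>: "\<mu> \<in># image_mset Re (proots (char_poly C))"
    using C0 by (auto intro!: image_eqI[of _ _ "complex_of_real \<mu>"])
  define R where "R = image_mset Re (proots (char_poly C)) - {#\<mu>#}"
  have R: "image_mset Re (proots (char_poly A)) = R + {#\<mu>, d#}"
    using \<mu> by (simp add: roots R_def)
  have R_le: "r \<le> \<mu>" if "r \<in># R" for r
    using that le unfolding R_def by (auto dest!: in_diffD)
  have "sorted (sorted_list_of_multiset R @ [\<mu>, d])"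
    using R_le less by (fastforce simp: sorted_append)
  moreover have "mset (sorted_list_of_multiset R @ [\<mu>, d]) = R + {#\<mu>, d#}"
    by simp
  ultimately have "sorted_list_of_multiset (R + {#\<mu>, d#}) = sorted_list_of_multiset R @ [\<mu>, d]"
    by (metis sorted_list_of_multiset_mset sorted_sort_id)
  then show ?thesis
    by (simp add: nth_eigenvalue_def eigenvalues_desc_def R)
qed

lemma nth_eigenvalue_1_scalar_mat:
  assumes "m > 0"
  shows "nth_eigenvalue 1 (complex_of_real \<mu> \<cdot>\<^sub>m 1\<^sub>m m) = \<mu>"
proof -
  let ?A = "complex_of_real \<mu> \<cdot>\<^sub>m 1\<^sub>m m"
  have "char_poly ?A = (\<Prod>a\<leftarrow>diag_mat ?A. [:- a, 1:])"
    by (rule char_poly_upper_triangular[of _ m]) auto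
  also have "diag_mat ?A = replicate m (complex_of_real \<mu>)"
    by (rule nth_equalityI) (auto simp: diag_mat_def)
  finally have "proots (char_poly ?A) = replicate_mset m (complex_of_real \<mu>)"
    by (simp add: proots_power)
  then have "sorted_list_of_multiset (image_mset Re (proots (char_poly ?A))) = replicate m \<mu>"
    by (metis Re_complex_of_real image_replicate_mset mset_replicate sorted_list_of_multiset_mset
        sorted_replicate sorted_sort_id)
  then show ?thesis using assms by (simp add: nth_eigenvalue_def eigenvalues_desc_def)
qed


section \<open>Permutations with many fixed points\<close>

(* keeps the interval {1..n} in the form in which the facts about its permutations are stated *)
declare One_nat_def [simp del]

lemma agreement_commute: "agreement A g h = agreement A h g"
  unfolding agreement_def by (rule arg_cong[where f = card]) auto

lemma agreement_comp_left:
  assumes "inj \<tau>"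
  shows "agreement A (\<tau> \<circ> g) (\<tau> \<circ> h) = agreement A g h"
  using assms by (simp add: agreement_def inj_eq)

lemma agreement_comp_right:
  assumes "\<tau> permutes A"
  shows "agreement A (g \<circ> \<tau>) (h \<circ> \<tau>) = agreement A g h"
  unfolding agreement_def
proof (rule bij_betw_same_card)
  show "bij_betw \<tau> {a \<in> A. (g \<circ> \<tau>) a = (h \<circ> \<tau>) a} {a \<in> A. g a = h a}"
    using assms permutes_in_image[OF assms] permutes_inv[OF assms] permutes_inverses(1)[OF assms]
    by (intro bij_betwI[where g = "inv' \<tau>"]) (auto simp: permutes_inverses permutes_in_image)
qed

lemma agreement_eq_fixed_points:
  assumes "g permutes A"
  shows "agreement A g h = agreement A (inv' g \<circ> h) id"
  using agreement_comp_left[of "inv' g" A h g] assms permutes_inv[OF assms]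
  by (metis agreement_commute permutes_inj permutes_inv_o(2))

lemma fixed_points_conj:
  assumes "\<tau> permutes A"
  shows "agreement A (\<tau> \<circ> \<sigma> \<circ> inv' \<tau>) id = agreement A \<sigma> id"
proof -
  have "agreement A (\<tau> \<circ> \<sigma> \<circ> inv' \<tau>) (\<tau> \<circ> id \<circ> inv' \<tau>) = agreement A \<sigma> id"
    using agreement_comp_right[OF permutes_inv[OF assms]] agreement_comp_left[OF permutes_inj[OF assms]]
    by metis
  then show ?thesis using permutes_inv_o(1)[OF assms] by simp
qed

definition close_perms_sending :: "nat \<Rightarrow> nat \<Rightarrow> nat \<Rightarrow> nat \<Rightarrow> real" where
  "close_perms_sending n j a c =
     (\<Sum>\<sigma> | \<sigma> permutes {1..n}. of_bool (j \<le> agreement {1..n} \<sigma> id) * of_bool (\<sigma> a = c))"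

text \<open>The eigenvalue on the standard representation of the sum of all permutations with at least \<open>j\<close>
  fixed points. The identity is included in this sum, so the eigenvalue of the Cayley graph is smaller
  by one.\<close>
definition std_eigenvalue :: "nat \<Rightarrow> nat \<Rightarrow> real" where
  "std_eigenvalue n j = (\<Sum>\<sigma> | \<sigma> permutes {1..n}.
     of_bool (j \<le> agreement {1..n} \<sigma> id) * (real (agreement {1..n} \<sigma> id) - 1)) / (real n - 1)"

lemma close_perms_sending_conj:
  assumes "\<tau> permutes {1..n}"
  shows "close_perms_sending n j (\<tau> a) (\<tau> c) = close_perms_sending n j a c"
  unfolding close_perms_sending_def
proof (rule sum.reindex_bij_witness[of _ "\<lambda>\<sigma>. \<tau> \<circ> \<sigma> \<circ> inv' \<tau>" "\<lambda>\<sigma>. inv' \<tau> \<circ> \<sigma> \<circ> \<tau>"])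
  note inv = permutes_inv[OF assms]
  note o = permutes_inv_o[OF assms]
  fix \<sigma> assume \<sigma>: "\<sigma> \<in> {\<sigma>. \<sigma> permutes {1..n}}"
  show "\<tau> \<circ> \<sigma> \<circ> inv' \<tau> \<in> {\<sigma>. \<sigma> permutes {1..n}}" "inv' \<tau> \<circ> \<sigma> \<circ> \<tau> \<in> {\<sigma>. \<sigma> permutes {1..n}}"
    using \<sigma> assms inv by (auto intro!: permutes_compose)
  show "\<tau> \<circ> (inv' \<tau> \<circ> \<sigma> \<circ> \<tau>) \<circ> inv' \<tau> = \<sigma>" "inv' \<tau> \<circ> (\<tau> \<circ> \<sigma> \<circ> inv' \<tau>) \<circ> \<tau> = \<sigma>"
    using permutes_inverses[OF assms] by (auto simp: fun_eq_iff)
  have "agreement {1..n} (inv' \<tau> \<circ> \<sigma> \<circ> \<tau>) id = agreement {1..n} \<sigma> id"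
    using fixed_points_conj[OF inv, of \<sigma>] permutes_inv_inv[OF assms] by simp
  moreover have "(inv' \<tau> \<circ> \<sigma> \<circ> \<tau>) a = c \<longleftrightarrow> \<sigma> (\<tau> a) = \<tau> c"
    using permutes_inv_eq[OF assms] by auto
  ultimately show "of_bool (j \<le> agreement {1..n} (inv' \<tau> \<circ> \<sigma> \<circ> \<tau>) id) * of_bool ((inv' \<tau> \<circ> \<sigma> \<circ> \<tau>) a = c) =
      (of_bool (j \<le> agreement {1..n} \<sigma> id) * of_bool (\<sigma> (\<tau> a) = \<tau> c) :: real)"
    by simp
qed

text \<open>Conjugation invariance and double transitivity leave one value on the diagonal and one off it; the
  trace and a row sum determine their difference.\<close>
lemma close_perms_sending_two_values:
  assumes n: "n \<ge> 2"
  obtains p where "\<And>a c. a \<in> {1..n} \<Longrightarrow> c \<in> {1..n} \<Longrightarrow>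
    close_perms_sending n j a c = p + of_bool (a = c) * std_eigenvalue n j"
proof -
  let ?w = "close_perms_sending n j" and ?P = "{\<sigma>. \<sigma> permutes {1..n}}"
  let ?b = "\<lambda>\<sigma>. of_bool (j \<le> agreement {1..n} \<sigma> id) :: real"
  define q where "q = ?w 1 1"
  define p where "p = ?w 1 2"
  have diag: "?w a a = q" if "a \<in> {1..n}" for a
    using close_perms_sending_conj[of "transpose 1 a" n j 1 1] that n
    by (simp add: q_def permutes_swap_id)
  have off: "?w a c = p" if "a \<in> {1..n}" "c \<in> {1..n}" "a \<noteq> c" for a c
  proof -
    \<comment> \<open>a permutation that sends 1 to \<open>a\<close> and 2 to \<open>c\<close>\<close>
    let ?x = "transpose 1 a 2"
    let ?t = "transpose ?x c \<circ> transpose 1 a"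
    have x: "?x \<in> {1..n}" "?x \<noteq> a" using that n by (auto simp: transpose_def)
    have "?t permutes {1..n}"
      using that n x by (intro permutes_compose permutes_swap_id) auto
    moreover have "?t 1 = a" "?t 2 = c" using that x by (auto simp: transpose_def)
    ultimately show ?thesis using close_perms_sending_conj[of ?t n j 1 2] by (simp add: p_def)
  qed
  have "real n * q = (\<Sum>a\<in>{1..n}. ?w a a)" using diag by simp
  also have "\<dots> = (\<Sum>\<sigma>\<in>?P. \<Sum>a\<in>{1..n}. ?b \<sigma> * of_bool (\<sigma> a = a))"
    unfolding close_perms_sending_def by (rule sum.swap)
  also have "\<dots> = (\<Sum>\<sigma>\<in>?P. ?b \<sigma> * real (agreement {1..n} \<sigma> id))"
    by (intro sum.cong refl) (simp add: sum_distrib_left[symmetric] agreement_def sum_of_bool_eq Int_def)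
  finally have trace: "real n * q = (\<Sum>\<sigma>\<in>?P. ?b \<sigma> * real (agreement {1..n} \<sigma> id))" .
  have "{1..n} = insert 1 {2..n}" using n by auto
  then have "q + (real n - 1) * p = (\<Sum>c\<in>{1..n}. ?w 1 c)"
    using off[of 1] n by (simp add: q_def of_nat_diff)
  also have "\<dots> = (\<Sum>\<sigma>\<in>?P. \<Sum>c\<in>{1..n}. ?b \<sigma> * of_bool (\<sigma> 1 = c))"
    unfolding close_perms_sending_def by (rule sum.swap)
  also have "\<dots> = (\<Sum>\<sigma>\<in>?P. ?b \<sigma>)"
  proof (intro sum.cong refl)
    fix \<sigma> assume "\<sigma> \<in> ?P"
    then have "\<sigma> 1 \<in> {1..n}" using n permutes_in_image[of \<sigma> "{1..n}" 1] by auto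
    then have "{1..n} \<inter> {c. \<sigma> 1 = c} = {\<sigma> 1}" by auto
    then show "(\<Sum>c\<in>{1..n}. ?b \<sigma> * of_bool (\<sigma> 1 = c)) = ?b \<sigma>"
      by (simp add: sum_distrib_left[symmetric] sum_of_bool_eq)
  qed
  finally have "(real n - 1) * (q - p) = (\<Sum>\<sigma>\<in>?P. ?b \<sigma> * (real (agreement {1..n} \<sigma> id) - 1))"
    using trace by (simp add: algebra_simps sum_subtractf)
  then have "q = p + std_eigenvalue n j"
    using n by (simp add: std_eigenvalue_def field_simps)
  then show ?thesis using that[of p] diag off by auto
qed

text \<open>The character of the standard representation is at most its dimension \<open>n - 1\<close>, and smaller at a
  transposition, which has \<open>n - 2 \<ge> j\<close> fixed points.\<close>
lemma std_eigenvalue_less_degree: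
  assumes "j + 2 \<le> n"
  shows "std_eigenvalue n j < (\<Sum>\<sigma> | \<sigma> permutes {1..n}. of_bool (j \<le> agreement {1..n} \<sigma> id))"
proof -
  let ?P = "{\<sigma>. \<sigma> permutes {1..n}}" and ?f = "\<lambda>\<sigma>. agreement {1..n} \<sigma> id"
  have n: "real n - 1 > 0" using assms by simp
  have "(\<Sum>\<sigma>\<in>?P. of_bool (j \<le> ?f \<sigma>) * (real (?f \<sigma>) - 1)) < (\<Sum>\<sigma>\<in>?P. of_bool (j \<le> ?f \<sigma>) * (real n - 1))"
  proof (rule sum_strict_mono_ex1)
    show "finite ?P" by (simp add: finite_permutations)
    show "\<forall>\<sigma>\<in>?P. of_bool (j \<le> ?f \<sigma>) * (real (?f \<sigma>) - 1) \<le> of_bool (j \<le> ?f \<sigma>) * (real n - 1)"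
      using agreement_le[of "{1..n}" _ id] by (auto simp: of_bool_def)
    let ?t = "transpose 1 2 :: nat \<Rightarrow> nat"
    have "{a \<in> {1..n}. ?t a = id a} = {1..n} - {1, 2}" by (auto simp: transpose_def)
    then have "?f ?t = n - 2" using assms by (simp add: agreement_def card_Diff_subset)
    moreover have "?t \<in> ?P" using assms by (auto intro: permutes_swap_id)
    ultimately show "\<exists>\<sigma>\<in>?P. of_bool (j \<le> ?f \<sigma>) * (real (?f \<sigma>) - 1) < of_bool (j \<le> ?f \<sigma>) * (real n - 1)"
      using assms by (intro bexI[of _ ?t]) auto
  qed
  then show ?thesis
    using n by (simp add: std_eigenvalue_def sum_distrib_right[symmetric] divide_less_eq)
qed

text \<open>The kernel is real, so a complex eigenvector contributes the forms of its real and of its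
  imaginary part.\<close>
lemma agreement_operator_bound:
  fixes v :: "(nat \<Rightarrow> nat) \<Rightarrow> complex"
  assumes n: "n \<ge> 3" and j: "j + 2 \<le> n"
    and sum0: "(\<Sum>g | g permutes {1..n}. v g) = 0"
    and nz: "g0 permutes {1..n}" "v g0 \<noteq> 0"
    and ev: "\<And>g. g permutes {1..n} \<Longrightarrow>
      (\<Sum>h | h permutes {1..n}. of_bool (j \<le> agreement {1..n} g h) * v h) = z * v g"
  shows "Re z \<le> std_eigenvalue n j"
proof -
  let ?P = "{p. p permutes {1..n}}"
  let ?K = "\<lambda>g h. of_bool (j \<le> agreement {1..n} g h) :: real"
  have K: "of_bool (j \<le> agreement {1..n} g h) = complex_of_real (?K g h)" for g h by simp
  define V where "V = (\<Sum>g\<in>?P. (Re (v g))\<^sup>2) + (\<Sum>g\<in>?P. (Im (v g))\<^sup>2)"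
  have V: "V = (\<Sum>g\<in>?P. (cmod (v g))\<^sup>2)"
    by (simp add: V_def sum.distrib[symmetric] cmod_power2)
  have "0 < V"
    unfolding V using nz by (intro sum_pos2[of _ g0]) (auto simp: finite_permutations)
  have "(\<Sum>g\<in>?P. cnj (v g) * (z * v g)) = z * complex_of_real V"
  proof -
    have "cnj (v g) * (z * v g) = z * complex_of_real ((cmod (v g))\<^sup>2)" for g
      using complex_norm_square[of "v g"] by (simp add: mult_ac)
    then have "(\<Sum>g\<in>?P. cnj (v g) * (z * v g)) = (\<Sum>g\<in>?P. z * complex_of_real ((cmod (v g))\<^sup>2))"
      by (simp only:)
    then show ?thesis unfolding V by (simp add: sum_distrib_left)
  qed
  then have "Re z * V = Re (\<Sum>g\<in>?P. cnj (v g) * (z * v g))" by simp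
  also have "\<dots> = Re (\<Sum>g\<in>?P. cnj (v g) * (\<Sum>h\<in>?P. of_bool (j \<le> agreement {1..n} g h) * v h))"
    using ev by (intro arg_cong[where f = Re] sum.cong refl) auto
  also have "\<dots> = (\<Sum>g\<in>?P. \<Sum>h\<in>?P. Re (v g) * Re (v h) * ?K g h) + (\<Sum>g\<in>?P. \<Sum>h\<in>?P. Im (v g) * Im (v h) * ?K g h)"
    unfolding sum.distrib[symmetric] Re_sum sum_distrib_left K
    by (intro sum.cong refl) (simp add: algebra_simps)
  also have "\<dots> \<le> std_eigenvalue n j * (\<Sum>g\<in>?P. (Re (v g))\<^sup>2) + std_eigenvalue n j * (\<Sum>g\<in>?P. (Im (v g))\<^sup>2)"
    unfolding std_eigenvalue_def
    using sum0 by (intro add_mono agreement_form_bound n j) (simp_all flip: Re_sum Im_sum)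
  also have "\<dots> = std_eigenvalue n j * V" by (simp add: V_def distrib_left)
  finally show ?thesis using \<open>0 < V\<close> by simp
qed

text \<open>The function \<open>[g 1 = 1] - [g 1 = 2]\<close> is a matrix coefficient of the standard representation.\<close>
lemma std_eigenvector:
  assumes n: "n \<ge> 2" and g: "g permutes {1..n}"
  shows "(\<Sum>h | h permutes {1..n}. of_bool (j \<le> agreement {1..n} g h) * (of_bool (h 1 = 1) - of_bool (h 1 = 2)))
    = std_eigenvalue n j * (of_bool (g 1 = 1) - of_bool (g 1 = 2))"
proof -
  let ?P = "{p. p permutes {1..n}}"
  obtain p where p: "\<And>a c. a \<in> {1..n} \<Longrightarrow> c \<in> {1..n} \<Longrightarrow>
    close_perms_sending n j a c = p + of_bool (a = c) * std_eigenvalue n j"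
    using close_perms_sending_two_values[OF n] by metis
  have inv_iff: "inv' g c = a \<longleftrightarrow> g a = c" for a c using permutes_inv_eq[OF g] by auto
  have "(\<Sum>h\<in>?P. of_bool (j \<le> agreement {1..n} g h) * of_bool (h 1 = c)) = close_perms_sending n j 1 (inv' g c)" for c
  proof -
    have "(\<Sum>h\<in>?P. of_bool (j \<le> agreement {1..n} g h) * of_bool (h 1 = c))
        = (\<Sum>h\<in>?P. of_bool (j \<le> agreement {1..n} (inv' g \<circ> h) id) * (of_bool ((inv' g \<circ> h) 1 = inv' g c) :: real))"
      by (intro sum.cong refl) (simp add: agreement_eq_fixed_points[OF g] permutes_inv_eq[OF g] permutes_inverses[OF g])
    also have "\<dots> = close_perms_sending n j 1 (inv' g c)"
      unfolding close_perms_sending_def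
      using setum_permutations_compose_left[OF permutes_inv[OF g],
          of "\<lambda>\<sigma>. of_bool (j \<le> agreement {1..n} \<sigma> id) * (of_bool (\<sigma> 1 = inv' g c) :: real)"] by simp
    finally show ?thesis .
  qed
  then have "(\<Sum>h\<in>?P. of_bool (j \<le> agreement {1..n} g h) * (of_bool (h 1 = 1) - of_bool (h 1 = 2)))
      = close_perms_sending n j 1 (inv' g 1) - close_perms_sending n j 1 (inv' g 2)"
    by (simp only: right_diff_distrib sum_subtractf)
  also have "\<dots> = std_eigenvalue n j * (of_bool (inv' g 1 = 1) - of_bool (inv' g 2 = 1))"
    using p permutes_in_image[OF permutes_inv[OF g]] n by (auto simp: algebra_simps)
  finally show ?thesis by (simp only: inv_iff)
qed

lemma sum_close_perms:
  assumes "g permutes {1..n}"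
  shows "(\<Sum>h | h permutes {1..n}. of_bool (j \<le> agreement {1..n} g h))
    = (\<Sum>\<sigma> | \<sigma> permutes {1..n}. of_bool (j \<le> agreement {1..n} \<sigma> id) :: real)"
  using setum_permutations_compose_left[OF permutes_inv[OF assms],
      of "\<lambda>\<sigma>. of_bool (j \<le> agreement {1..n} \<sigma> id) :: real"]
  by (simp add: agreement_eq_fixed_points[OF assms])

section \<open>The Cayley graph\<close>

lemma small_support_perms_eq:
  assumes "k \<le> n"
  shows "small_support_perms n k =
    {\<sigma>. \<sigma> permutes {1..n} \<and> \<sigma> \<noteq> id \<and> n - k \<le> agreement {1..n} \<sigma> id}"
proof -
  have card: "card (perm_supp n \<sigma>) + agreement {1..n} \<sigma> id = n" for \<sigma>
  proof -
    have "perm_supp n \<sigma> \<union> {a \<in> {1..n}. \<sigma> a = id a} = {1..n}" by (auto simp: perm_supp_def)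
    moreover have "perm_supp n \<sigma> \<inter> {a \<in> {1..n}. \<sigma> a = id a} = {}" by (auto simp: perm_supp_def)
    ultimately show ?thesis
      using card_Un_disjoint[of "perm_supp n \<sigma>" "{a \<in> {1..n}. \<sigma> a = id a}"]
      by (simp add: agreement_def perm_supp_def)
  qed
  have two: "2 \<le> card (perm_supp n \<sigma>)" if "\<sigma> permutes {1..n}" "\<sigma> \<noteq> id" for \<sigma>
    using agreement_permutes_distinct[OF _ that(1) permutes_id that(2)] card[of \<sigma>] by simp
  have "card (perm_supp n id) = 0" by (simp add: perm_supp_def)
  then have "(2 \<le> card (perm_supp n \<sigma>) \<and> card (perm_supp n \<sigma>) \<le> k)
      \<longleftrightarrow> (\<sigma> \<noteq> id \<and> n - k \<le> agreement {1..n} \<sigma> id)" if "\<sigma> permutes {1..n}" for \<sigma>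
    using two[OF that] card[of \<sigma>] assms by (cases "\<sigma> = id") auto
  then show ?thesis
    unfolding small_support_perms_def sym_group_carrier by blast
qed

lemma sum_small_support_perms:
  fixes F :: "(nat \<Rightarrow> nat) \<Rightarrow> real"
  assumes "k \<le> n"
  shows "(\<Sum>s\<in>small_support_perms n k. F s)
    = (\<Sum>\<sigma> | \<sigma> permutes {1..n}. of_bool (n - k \<le> agreement {1..n} \<sigma> id) * F \<sigma>) - F id"
proof -
  let ?P = "{p. p permutes {1..n}}"
  let ?T = "{\<sigma>\<in>?P. n - k \<le> agreement {1..n} \<sigma> id}"
  have T: "id \<in> ?T" "finite ?T" "small_support_perms n k = ?T - {id}"
  proof -
    show "id \<in> ?T" by (simp add: permutes_id agreement_self)
    show "finite ?T" by (simp add: finite_permutations)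
    show "small_support_perms n k = ?T - {id}"
      unfolding small_support_perms_eq[OF assms] by blast
  qed
  have "(\<Sum>\<sigma>\<in>?P. of_bool (n - k \<le> agreement {1..n} \<sigma> id) * F \<sigma>) = (\<Sum>\<sigma>\<in>?T. F \<sigma>)"
    by (subst sum.inter_filter) (auto simp: finite_permutations of_bool_def intro!: sum.cong)
  then show ?thesis using T by (simp add: sum_diff1)
qed

lemma std_rep_sum_scalar:
  assumes n: "n \<ge> 2" and k: "k \<le> n"
  shows "std_rep_sum n (small_support_perms n k)
    = complex_of_real (std_eigenvalue n (n - k) - 1) \<cdot>\<^sub>m 1\<^sub>m (n - 1)"
proof (rule eq_matI)
  let ?S = "small_support_perms n k"
  obtain p where p: "\<And>a c. a \<in> {1..n} \<Longrightarrow> c \<in> {1..n} \<Longrightarrow>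
    close_perms_sending n (n - k) a c = p + of_bool (a = c) * std_eigenvalue n (n - k)"
    using close_perms_sending_two_values[OF n] by metis
  fix i l assume "i < dim_row (complex_of_real (std_eigenvalue n (n - k) - 1) \<cdot>\<^sub>m 1\<^sub>m (n - 1))"
    "l < dim_col (complex_of_real (std_eigenvalue n (n - k) - 1) \<cdot>\<^sub>m 1\<^sub>m (n - 1))"
  then have il: "i < n - 1" "l < n - 1" by auto
  define F :: "(nat \<Rightarrow> nat) \<Rightarrow> real"
    where "F \<sigma> = of_bool (\<sigma> (l + 2) = i + 2) - of_bool (\<sigma> 1 = i + 2)" for \<sigma>
  have "std_rep_sum n ?S $$ (i, l) = complex_of_real (\<Sum>s\<in>?S. F s)"
    using il by (auto simp: std_rep_sum_def std_rep_def F_def of_bool_def intro!: sum.cong)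
  also have "(\<Sum>s\<in>?S. F s) = close_perms_sending n (n - k) (l + 2) (i + 2) - close_perms_sending n (n - k) 1 (i + 2) - F id"
    unfolding sum_small_support_perms[OF k] close_perms_sending_def F_def
    by (simp only: right_diff_distrib sum_subtractf)
  also have "\<dots> = of_bool (l = i) * (std_eigenvalue n (n - k) - 1)"
    using il by (subst (1 2) p) (auto simp: F_def)
  finally show "std_rep_sum n ?S $$ (i, l)
      = (complex_of_real (std_eigenvalue n (n - k) - 1) \<cdot>\<^sub>m 1\<^sub>m (n - 1)) $$ (i, l)"
    using il by auto
qed (auto simp: std_rep_sum_def)

lemma cayley_arc_iff:
  assumes k: "k \<le> n" and gh: "g permutes {1..n}" "h permutes {1..n}"
  shows "(g, h) \<in> parcs (cayley_graph (sym_group n) (small_support_perms n k))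
    \<longleftrightarrow> g \<noteq> h \<and> n - k \<le> agreement {1..n} g h"
proof -
  have "(g, h) \<in> parcs (cayley_graph (sym_group n) (small_support_perms n k))
      \<longleftrightarrow> inv' g \<circ> h \<in> small_support_perms n k"
  proof -
    have "h = g \<circ> s \<longleftrightarrow> s = inv' g \<circ> h" for s
      by (metis gh(1) id_comp o_assoc permutes_inv_o)
    then show ?thesis using gh by (auto simp: cayley_graph_def sym_group_carrier sym_group_mult)
  qed
  also have "\<dots> \<longleftrightarrow> inv' g \<circ> h \<noteq> id \<and> n - k \<le> agreement {1..n} g h"
    using gh permutes_inv[OF gh(1)]
    by (auto simp: small_support_perms_eq[OF k] agreement_eq_fixed_points[OF gh(1)] intro: permutes_compose)
  also have "inv' g \<circ> h = id \<longleftrightarrow> g = h"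
    by (metis comp_id gh(1) id_comp o_assoc permutes_inv_o)
  finally show ?thesis .
qed

lemma nth_eigenvalue_2_cayley:
  assumes n: "n \<ge> 3" and k: "2 \<le> k" "k \<le> n"
  shows "nth_eigenvalue 2 (adjacency_matrix (cayley_graph (sym_group n) (small_support_perms n k)))
    = std_eigenvalue n (n - k) - 1"
proof -
  let ?P = "{p. p permutes {1..n}}" and ?X = "cayley_graph (sym_group n) (small_support_perms n k)"
  let ?ag = "agreement {1..n}"
  define j where "j = n - k"
  have j: "j + 2 \<le> n" using k by (simp add: j_def)
  define vs where "vs = vertex_enumeration ?X"
  define N where "N = length vs"
  have P: "finite ?P" by (simp add: finite_permutations)
  have "pverts ?X = ?P" by (auto simp: cayley_graph_def sym_group_carrier)
  then have vs: "distinct vs" "set vs = ?P"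
    using someI_ex[OF finite_distinct_list[OF P]] unfolding vs_def vertex_enumeration_def
    by (auto simp: conj_commute)
  have bij: "bij_betw ((!) vs) {..<N} ?P"
    using vs by (intro bij_betw_nth) (auto simp: N_def)
  have vsP: "vs ! i permutes {1..n}" if "i < N" for i
    using vs that nth_mem[of i vs] by (auto simp: N_def)
  have sum_vs: "(\<Sum>i<N. f (vs ! i)) = (\<Sum>h\<in>?P. f h)" for f :: "(nat \<Rightarrow> nat) \<Rightarrow> complex"
    by (rule sum.reindex_bij_betw[OF bij])
  have id_vs: "id \<in> set vs" using vs permutes_id by simp
  then have N: "N > 0" by (cases vs) (auto simp: N_def)
  define A where "A = adjacency_matrix ?X"
  have A: "A \<in> carrier_mat N N"
    by (simp add: A_def adjacency_matrix_def Let_def vs_def[symmetric] N_def)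
  have entry: "A $$ (i, l) = of_bool (j \<le> ?ag (vs ! i) (vs ! l)) - of_bool (l = i)"
    if "i < N" "l < N" for i l
  proof -
    have "vs ! i = vs ! l \<longleftrightarrow> l = i" using vs that by (auto simp: N_def nth_eq_iff_index_eq)
    moreover have "j \<le> ?ag (vs ! i) (vs ! i)" by (simp add: agreement_self j_def)
    ultimately show ?thesis
      using that cayley_arc_iff[OF k(2) vsP[OF that(1)] vsP[OF that(2)]]
      by (auto simp: A_def adjacency_matrix_def Let_def vs_def[symmetric] N_def j_def)
  qed
  have mult_vec: "(\<Sum>l<N. A $$ (i, l) * f (vs ! l)) = (\<Sum>h\<in>?P. of_bool (j \<le> ?ag (vs ! i) h) * f h) - f (vs ! i)"
    if "i < N" for i f
  proof -
    have "(\<Sum>l<N. A $$ (i, l) * f (vs ! l))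
        = (\<Sum>l<N. of_bool (j \<le> ?ag (vs ! i) (vs ! l)) * f (vs ! l) - (if l = i then f (vs ! l) else 0))"
      using that by (intro sum.cong refl) (auto simp: entry left_diff_distrib)
    also have "\<dots> = (\<Sum>l<N. of_bool (j \<le> ?ag (vs ! i) (vs ! l)) * f (vs ! l)) - f (vs ! i)"
      using that by (simp add: sum_subtractf)
    also have "(\<Sum>l<N. of_bool (j \<le> ?ag (vs ! i) (vs ! l)) * f (vs ! l)) = (\<Sum>h\<in>?P. of_bool (j \<le> ?ag (vs ! i) h) * f h)"
      by (rule sum_vs[of "\<lambda>h. of_bool (j \<le> ?ag (vs ! i) h) * f h"])
    finally show ?thesis .
  qed
  have K: "complex_of_real (of_bool b) = of_bool b" for b by (cases b) simp_all
  define D where "D = (\<Sum>\<sigma>\<in>?P. of_bool (j \<le> ?ag \<sigma> id) :: real)"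
  have row: "(\<Sum>l<N. A $$ (i, l)) = complex_of_real (D - 1)" if "i < N" for i
  proof -
    have "(\<Sum>h\<in>?P. of_bool (j \<le> ?ag (vs ! i) h)) = complex_of_real (\<Sum>h\<in>?P. of_bool (j \<le> ?ag (vs ! i) h))"
      by (simp add: K)
    then show ?thesis
      using mult_vec[OF that, of "\<lambda>_. 1"] sum_close_perms[OF vsP[OF that], of j] by (simp add: D_def)
  qed
  have "A $$ (i, l) = A $$ (l, i)" if "i < N" "l < N" for i l
    using that by (auto simp: entry agreement_commute)
  then have col: "(\<Sum>i<N. A $$ (i, l)) = complex_of_real (D - 1)" if "l < N" for l
    using row[OF that] that by (simp cong: sum.cong_simp)
  define \<mu> where "\<mu> = std_eigenvalue n j - 1"
  define v :: "(nat \<Rightarrow> nat) \<Rightarrow> real" where "v g = of_bool (g 1 = 1) - of_bool (g 1 = 2)" for g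
  have "nth_eigenvalue 2 A = \<mu>"
  proof (rule nth_eigenvalue_2_eqI[OF A N row col, where x = "\<lambda>i. complex_of_real (v (vs ! i))"])
    show "\<mu> < D - 1"
      using std_eigenvalue_less_degree[OF j] by (simp add: \<mu>_def D_def)
    from id_vs obtain i where "i < N" "vs ! i = id" by (auto simp: in_set_conv_nth N_def)
    then show "\<exists>i<N. complex_of_real (v (vs ! i)) \<noteq> 0" by (intro exI[of _ i]) (auto simp: v_def)
    show "(\<Sum>l<N. A $$ (i, l) * complex_of_real (v (vs ! l))) = complex_of_real \<mu> * complex_of_real (v (vs ! i))"
      if "i < N" for i
    proof -
      have "(\<Sum>h\<in>?P. of_bool (j \<le> ?ag (vs ! i) h) * complex_of_real (v h))
          = complex_of_real (\<Sum>h\<in>?P. of_bool (j \<le> ?ag (vs ! i) h) * v h)" by (simp add: K)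
      also have "\<dots> = complex_of_real (std_eigenvalue n j * v (vs ! i))"
        using std_eigenvector[OF _ vsP[OF that], of j] n by (simp only: v_def)
      finally show ?thesis
        using mult_vec[OF that, of "\<lambda>h. complex_of_real (v h)"] by (simp add: \<mu>_def algebra_simps)
    qed
    fix z y
    assume y: "\<exists>i<N. y i \<noteq> 0" "(\<Sum>i<N. y i) = 0"
      "\<And>i. i < N \<Longrightarrow> (\<Sum>l<N. A $$ (i, l) * y l) = z * y i"
    define u where "u g = y (inv_into {..<N} ((!) vs) g)" for g
    have u: "u (vs ! i) = y i" if "i < N" for i
      using bij that by (simp add: u_def bij_betw_inv_into_left)
    obtain i where i: "i < N" "y i \<noteq> 0" using y(1) by blast
    have "Re (z + 1) \<le> std_eigenvalue n j"
    proof (rule agreement_operator_bound[OF n j])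
      show "(\<Sum>g\<in>?P. u g) = 0" using sum_vs[of u] u y(2) by (simp cong: sum.cong_simp)
      show "vs ! i permutes {1..n}" "u (vs ! i) \<noteq> 0" using i u vsP by auto
      show "(\<Sum>h\<in>?P. of_bool (j \<le> ?ag g h) * u h) = (z + 1) * u g" if "g permutes {1..n}" for g
      proof -
        have "g \<in> set vs" using vs that by auto
        then obtain l where l: "l < N" "vs ! l = g" by (auto simp: in_set_conv_nth N_def)
        have "(\<Sum>m<N. A $$ (l, m) * u (vs ! m)) = z * u g"
          using y(3)[OF l(1)] u[OF l(1)] l(2) by (simp add: u cong: sum.cong_simp)
        then show ?thesis using mult_vec[OF l(1), of u] l(2) by (simp add: algebra_simps)
      qed
    qed
    then show "Re z \<le> \<mu>" by (simp add: \<mu>_def)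
  qed
  then show ?thesis by (simp add: A_def \<mu>_def j_def)
qed

lemma transpose_in_small_support_perms:
  assumes "2 \<le> k" "a \<in> {1..n}" "b \<in> {1..n}" "a \<noteq> b"
  shows "transpose a b \<in> small_support_perms n k"
proof -
  have "perm_supp n (transpose a b) = {a, b}"
    using assms by (auto simp: perm_supp_def transpose_def)
  then show ?thesis
    using assms by (simp add: small_support_perms_def sym_group_carrier permutes_swap_id)
qed

lemma normal_small_support_perms:
  assumes k: "k \<le> n"
  shows "normal_connection_set (sym_group n) (small_support_perms n k)"
proof -
  have inv_mem: "inv' s \<in> small_support_perms n k" if "s \<in> small_support_perms n k" for s
  proof -
    have s: "s permutes {1..n}" "s \<noteq> id" "n - k \<le> agreement {1..n} s id"
      using that by (auto simp: small_support_perms_eq[OF k])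
    have "agreement {1..n} (inv' s) id = agreement {1..n} s id"
      using agreement_eq_fixed_points[OF s(1), of id] by simp
    moreover have "inv' s \<noteq> id" using s(2) permutes_inv_inv[OF s(1)] by (metis inv_id)
    ultimately show ?thesis using s permutes_inv[OF s(1)] by (simp add: small_support_perms_eq[OF k])
  qed
  have conj_mem: "g \<circ> s \<circ> inv' g \<in> small_support_perms n k"
    if s: "s \<in> small_support_perms n k" and g: "g permutes {1..n}" for s g
  proof -
    have "g \<circ> s \<circ> inv' g \<noteq> id"
    proof
      assume "g \<circ> s \<circ> inv' g = id"
      then have "g (s x) = g x" for x
        using permutes_inverses[OF g] by (metis comp_apply id_apply)
      then show False using s permutes_inj[OF g]
        by (auto simp: small_support_perms_eq[OF k] fun_eq_iff inj_eq)
    qed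
    then show ?thesis
      using s g permutes_inv[OF g] fixed_points_conj[OF g]
      by (auto simp: small_support_perms_eq[OF k] intro!: permutes_compose)
  qed
  show ?thesis
    unfolding normal_connection_set_def connection_set_def
    using inv_mem conj_mem
    by (auto simp: sym_group_carrier sym_group_mult sym_group_one small_support_perms_eq[OF k])
qed

lemma generate_small_support_perms:
  assumes "2 \<le> k"
  shows "generate (sym_group n) (small_support_perms n k) = carrier (sym_group n)"
proof
  show "generate (sym_group n) (small_support_perms n k) \<subseteq> carrier (sym_group n)"
    by (intro group.generate_incl[OF sym_group_is_group]) (auto simp: small_support_perms_def)
  show "carrier (sym_group n) \<subseteq> generate (sym_group n) (small_support_perms n k)"
  proof
    fix p assume "p \<in> carrier (sym_group n)"
    then have "p permutes {1..n}" by (simp add: sym_group_carrier)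
    with finite_atLeastAtMost show "p \<in> generate (sym_group n) (small_support_perms n k)"
    proof (induction rule: permutes_rev_induct)
      case id
      show ?case using generate.one[of "sym_group n"] unfolding sym_group_one .
    next
      case (swap a b p)
      then have "transpose a b \<in> generate (sym_group n) (small_support_perms n k)"
        using assms by (intro generate.incl transpose_in_small_support_perms)
      then show ?case using generate.eng swap by (metis sym_group_mult)
    qed
  qed
qed

lemma connected_small_support_perms:
  assumes k: "2 \<le> k" "k \<le> n"
  shows "Digraph_Component.connected (with_proj (cayley_graph (sym_group n) (small_support_perms n k)))"
proof -
  let ?X = "cayley_graph (sym_group n) (small_support_perms n k)"
  let ?Y = "mk_symmetric (with_proj ?X)"
  have verts: "pverts ?Y = {p. p permutes {1..n}}"
    by (auto simp: mk_symmetric_def cayley_graph_def sym_group_carrier)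
  have arcs: "(g, h) \<in> parcs ?Y" if "(g, h) \<in> parcs ?X" for g h
    using that by (auto simp: mk_symmetric_def)
  interpret X: pair_graph ?X
    using normal_small_support_perms[OF k(2)]
    by (intro pair_graph_cayley_graph sym_group_is_group)
      (auto simp: normal_connection_set_def sym_group_def finite_permutations)
  interpret Y: pair_wf_digraph ?Y
    using X.wf_digraph_axioms by (rule wf_digraph.wellformed_mk_symmetric)
  have reach: "u \<rightarrow>\<^sup>*\<^bsub>with_proj ?Y\<^esub> (u \<circ> p)" if u: "u permutes {1..n}" and p: "p permutes {1..n}" for u p
    using finite_atLeastAtMost p
  proof (induction rule: permutes_rev_induct)
    case id
    then show ?case using u verts by (auto simp: reachable_def intro: rtrancl_on_refl)
  next
    case (swap a b p)
    have "transpose a b \<in> small_support_perms n k"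
      using swap k by (intro transpose_in_small_support_perms)
    moreover have "u \<circ> p permutes {1..n}" using u swap by (auto intro: permutes_compose)
    ultimately have "(u \<circ> p, u \<circ> (p \<circ> transpose a b)) \<in> parcs ?X"
      by (auto simp: cayley_graph_def sym_group_carrier sym_group_mult o_assoc)
    then have "(u \<circ> p, u \<circ> (p \<circ> transpose a b)) \<in> parcs ?Y" by (rule arcs)
    then have "(u \<circ> p, u \<circ> (p \<circ> transpose a b)) \<in> arcs_ends (with_proj ?Y)" by simp
    with swap.IH show ?case by (rule wf_digraph.reachable_adj_trans[OF Y.wf_digraph_axioms])
  qed
  have "u \<rightarrow>\<^sup>*\<^bsub>with_proj ?Y\<^esub> v" if "u permutes {1..n}" "v permutes {1..n}" for u v
    using reach[OF that(1), of "inv' u \<circ> v"] that permutes_inv[OF that(1)] permutes_inv_o(1)[OF that(1)]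
    by (simp add: permutes_compose o_assoc)
  then show ?thesis
    unfolding connected_def strongly_connected_def using verts permutes_id by fastforce
qed

lemma card_rcosets_carrier:
  assumes "group G" "finite (carrier G)"
  shows "card (rcosets\<^bsub>G\<^esub> (carrier G)) = 1"
proof -
  interpret group G by fact
  have "card (rcosets\<^bsub>G\<^esub> (carrier G)) * card (carrier G) = Coset.order G"
    by (rule lagrange) (rule subgroup_self)
  then show ?thesis using assms(2) by (auto simp: Coset.order_def card_eq_0_iff)
qed

theorem theorem1p4:
  shows "\<exists>N::nat. N > 0 \<and> (\<forall>n\<ge>N. \<forall>k::nat. 2 \<le> k \<and> k \<le> n \<longrightarrow>
    normal_connection_set (sym_group n) (small_support_perms n k) \<and>
    Digraph_Component.connected (with_proj (cayley_graph (sym_group n) (small_support_perms n k))) \<and>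
    aldous_property n (small_support_perms n k))"
proof (intro exI[of _ "3::nat"] conjI allI impI)
  fix n k :: nat assume n: "3 \<le> n" and k: "2 \<le> k \<and> k \<le> n"
  show "normal_connection_set (sym_group n) (small_support_perms n k)"
    using k by (intro normal_small_support_perms) auto
  show "Digraph_Component.connected (with_proj (cayley_graph (sym_group n) (small_support_perms n k)))"
    using k by (intro connected_small_support_perms) auto
  have "card (rcosets\<^bsub>sym_group n\<^esub> (generate (sym_group n) (small_support_perms n k))) = 1"
    using k generate_small_support_perms[of k n]
      card_rcosets_carrier[OF sym_group_is_group, of n] by (simp add: sym_group_def finite_permutations)
  moreover have "nth_eigenvalue 1 (std_rep_sum n (small_support_perms n k)) = std_eigenvalue n (n - k) - 1"
    using n k by (subst std_rep_sum_scalar) (auto intro!: nth_eigenvalue_1_scalar_mat simp del: of_real_diff)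
  ultimately show "aldous_property n (small_support_perms n k)"
    using n k nth_eigenvalue_2_cayley[of n k] by (simp add: aldous_property_def)
qed simp

end
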